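(* For every sleep rate $\lambda\in(0,\infty]$, the inner density $\zeta_{in}=\zeta_{in}(\mathbb Z,\lambda)$ and the outer density $\zeta_{out}=\zeta_{out}(\mathbb Z,\lambda)$ of Activated Random Walk on $\mathbb Z$ satisfy $\zeta_{in}\ge\zeta_{out}$.
   Context: **Activated Random Walk (ARW) on $\mathbb Z$ with sleep rate $\lambda\in(0,\infty]$.** $\mathbb N=\{0,1,2,\dots\}$, $\mathbb N_s=\mathbb N\cup\{s\}$, ordered $0<s<1<2<\cdots$. A configuration is a map $\eta:\mathbb Z\to\mathbb N_s$: $\eta(x)=k\ge1$ means $k$ active particles at $x$, $\eta(x)=s$ one sleeping particle, $\eta(x)=0$ no particle. Each site $x$ carries a stack $(\rho_x(k))_{k\ge1}$ of instructions; all instructions are independent, and $\rho_x(k)=s$ with probability $\frac{\lambda}{1+\lambda}$, $\rho_x(k)=x-1$ or $x+1$ with probability $\frac1{2(1+\lambda)}$ each. Firing $x$ means using the first unused instruction at $x$: instruction $x\pm1$ moves one particle from $x$ to that site (a sleeping particle there becomes active); instruction $s$ makes the particle at $x$ fall asleep if it is alone at $x$ and has no effect otherwise. Firing $x$ is legal if $\eta(x)\ge1$. A configuration is stable if it takes values in $\{0,s\}$. Stabilizing a configuration means performing legal firings until it is stable; the number of firings at each site and the final configuration do not depend on the order of legal firings (Abelian property). For $\lambda=\infty$ (Internal DLA): the stacks contain only the instructions $x\pm1$, each with probability $1/2$, and an active particle alone at its site becomes asleep instantly without firing, so that only sites with at least two particles fire. **Outer density.** For $\zeta\in(0,1)$ let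 $(\eta(x))_{x\in\mathbb Z}$ be i.i.d. Bernoulli($\zeta$), independent of the stacks, viewed as a configuration with one active particle at each $x$ with $\eta(x)=1$. Let $\mathbf E_\zeta$ be expectation with respect to the joint law of $\eta$ and the stacks. Let $w(x)\in\mathbb N\cup\{\infty\}$ be the number of firings needed at $x$ to stabilize $\eta$, i.e. the supremum, over finite legal firing sequences for $\eta$, of the number of firings at $x$. Define $\zeta_{out}=\sup\{\zeta>0:\mathbf E_\zeta(w(0)^3)<\infty\}$ (with $\sup\emptyset=0$). **Inner density.** For a finite interval $I\subset\mathbb Z$ let $\mathbf 1_I$ be the configuration with one active particle at each site of $I$ and none elsewhere. Let $\mathcal S_I(\mathbf 1_I)$ be its stabilization when particles stepping outside $I$ are immediately removed, and $|\mathcal S_I(\mathbf 1_I)|$ the number of (sleeping) particles in the final configuration. Define $\zeta_{in,I}=\inf\{\zeta>0:\mathbb P(|\mathcal S_I(\mathbf 1_I)|>\zeta\,\#I)\le(\#I)^{-20}\}$ and $\zeta_{in}=\limsup_{\#I\to\infty}\zeta_{in,I}$. *)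

theory Defs
  imports "HOL-Probability.Probability"
begin

text \<open>
  A sleep rate is a positive extended real; the value \<open>\<infinity>\<close> is Internal DLA.
\<close>

datatype instr = GoLeft | GoRight | Doze

text \<open>Site contents are the natural numbers with an extra element \<open>s\<close>:
  \<open>Awake k\<close> is \<open>k\<close> active particles, so \<open>Awake 0\<close> is an empty site, and \<open>Asleep\<close> is \<open>s\<close>.\<close>

datatype content = Awake nat | Asleep

type_synonym config = "int \<Rightarrow> content"

text \<open>Stacks are indexed from \<open>0\<close>: \<open>\<rho> (x, k)\<close> is the instruction used by the firing of \<open>x\<close> that
  is preceded by exactly \<open>k\<close> firings of \<open>x\<close>.\<close>

type_synonym stacks = "int \<times> nat \<Rightarrow> instr"

fun active :: "content \<Rightarrow> bool" where
  "active (Awake k) \<longleftrightarrow> k \<ge> 1"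
| "active Asleep \<longleftrightarrow> False"

definition stable :: "config \<Rightarrow> bool" where
  "stable \<eta> \<longleftrightarrow> (\<forall>x. \<eta> x \<in> {Awake 0, Asleep})"

text \<open>An arriving particle wakes up a sleeping one, which leaves two active particles.\<close>

fun add_particle :: "content \<Rightarrow> content" where
  "add_particle (Awake k) = Awake (k + 1)"
| "add_particle Asleep = Awake 2"

text \<open>Only ever applied to active sites.\<close>

fun remove_particle :: "content \<Rightarrow> content" where
  "remove_particle (Awake k) = Awake (k - 1)"
| "remove_particle Asleep = Asleep"

definition fall_asleep :: "content \<Rightarrow> content" where
  "fall_asleep c = (if c = Awake 1 then Asleep else c)"

text \<open>Particles that step outside \<open>D\<close> are removed; \<open>D = UNIV\<close> is the dynamics on the whole line.\<close>

definition move :: "int set \<Rightarrow> int \<Rightarrow> int \<Rightarrow> config \<Rightarrow> config" where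
  "move D x y \<eta> =
     (let \<eta>' = \<eta>(x := remove_particle (\<eta> x))
      in if y \<in> D then \<eta>'(y := add_particle (\<eta>' y)) else \<eta>')"

fun apply_instr :: "int set \<Rightarrow> instr \<Rightarrow> int \<Rightarrow> config \<Rightarrow> config" where
  "apply_instr D GoLeft x \<eta> = move D x (x - 1) \<eta>"
| "apply_instr D GoRight x \<eta> = move D x (x + 1) \<eta>"
| "apply_instr D Doze x \<eta> = \<eta>(x := fall_asleep (\<eta> x))"

text \<open>At infinite sleep rate, particles that are alone at their site fall asleep without any firing.
  This is applied to the initial configuration and after each firing, so that the active sites are
  then exactly those with at least two particles.\<close>

definition settle :: "ereal \<Rightarrow> config \<Rightarrow> config" where
  "settle lam \<eta> = (if lam = \<infinity> then (\<lambda>x. fall_asleep (\<eta> x)) else \<eta>)"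

text \<open>A state consists of a configuration and the number of firings performed so far at each site.\<close>

type_synonym state = "config \<times> (int \<Rightarrow> nat)"

definition init :: "ereal \<Rightarrow> config \<Rightarrow> state" where
  "init lam \<eta> = (settle lam \<eta>, \<lambda>_. 0)"

fun fire :: "ereal \<Rightarrow> int set \<Rightarrow> stacks \<Rightarrow> int \<Rightarrow> state \<Rightarrow> state" where
  "fire lam D \<rho> x (\<eta>, u) =
     (settle lam (apply_instr D (\<rho> (x, u x)) x \<eta>), u(x := u x + 1))"

fun run :: "ereal \<Rightarrow> int set \<Rightarrow> stacks \<Rightarrow> int list \<Rightarrow> state \<Rightarrow> state" where
  "run lam D \<rho> [] st = st"
| "run lam D \<rho> (x # xs) st = run lam D \<rho> xs (fire lam D \<rho> x st)"

fun legal :: "ereal \<Rightarrow> int set \<Rightarrow> stacks \<Rightarrow> int list \<Rightarrow> state \<Rightarrow> bool" where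
  "legal lam D \<rho> [] st \<longleftrightarrow> True"
| "legal lam D \<rho> (x # xs) st \<longleftrightarrow> active (fst st x) \<and> legal lam D \<rho> xs (fire lam D \<rho> x st)"

definition firings :: "ereal \<Rightarrow> stacks \<Rightarrow> config \<Rightarrow> int \<Rightarrow> enat" where
  "firings lam \<rho> \<eta> x =
     (SUP xs \<in> {xs. legal lam UNIV \<rho> xs (init lam \<eta>)}. enat (count_list xs x))"

text \<open>Well defined as soon as some finite legal sequence stabilizes \<open>\<eta>\<close>, by the Abelian property.\<close>

definition stabilization :: "ereal \<Rightarrow> int set \<Rightarrow> stacks \<Rightarrow> config \<Rightarrow> config" where
  "stabilization lam D \<rho> \<eta> =
     (THE \<eta>'. \<exists>xs. legal lam D \<rho> xs (init lam \<eta>) \<and>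
                   \<eta>' = fst (run lam D \<rho> xs (init lam \<eta>)) \<and> stable \<eta>')"

definition instr_pmf :: "ereal \<Rightarrow> instr pmf" where
  "instr_pmf lam =
     (if lam = \<infinity> then pmf_of_set {GoLeft, GoRight}
      else bind_pmf (bernoulli_pmf (real_of_ereal lam / (1 + real_of_ereal lam)))
             (\<lambda>b. if b then return_pmf Doze else pmf_of_set {GoLeft, GoRight}))"

lemma pmf_instr_infinite:
  "pmf (instr_pmf \<infinity>) Doze = 0"
  "pmf (instr_pmf \<infinity>) GoLeft = 1 / 2"
  "pmf (instr_pmf \<infinity>) GoRight = 1 / 2"
  by (simp_all add: instr_pmf_def)

lemma pmf_instr_finite:
  assumes "l > 0"
  shows "pmf (instr_pmf (ereal l)) Doze = l / (1 + l)"
    and "pmf (instr_pmf (ereal l)) GoLeft = 1 / (2 * (1 + l))"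
    and "pmf (instr_pmf (ereal l)) GoRight = 1 / (2 * (1 + l))"
proof -
  have "0 \<le> l / (1 + l)" "l / (1 + l) \<le> 1" using assms by auto
  then show "pmf (instr_pmf (ereal l)) Doze = l / (1 + l)"
    and "pmf (instr_pmf (ereal l)) GoLeft = 1 / (2 * (1 + l))"
    and "pmf (instr_pmf (ereal l)) GoRight = 1 / (2 * (1 + l))"
    using assms by (simp_all add: instr_pmf_def pmf_bind field_simps)
qed

definition stack_measure :: "ereal \<Rightarrow> stacks measure" where
  "stack_measure lam = PiM UNIV (\<lambda>_. measure_pmf (instr_pmf lam))"

definition bernoulli_measure :: "real \<Rightarrow> (int \<Rightarrow> bool) measure" where
  "bernoulli_measure \<zeta> = PiM UNIV (\<lambda>_. measure_pmf (bernoulli_pmf \<zeta>))"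

definition joint_measure :: "ereal \<Rightarrow> real \<Rightarrow> ((int \<Rightarrow> bool) \<times> stacks) measure" where
  "joint_measure lam \<zeta> = bernoulli_measure \<zeta> \<Otimes>\<^sub>M stack_measure lam"

definition config_of :: "(int \<Rightarrow> bool) \<Rightarrow> config" where
  "config_of b = (\<lambda>x. if b x then Awake 1 else Awake 0)"

definition firings_third_moment :: "ereal \<Rightarrow> real \<Rightarrow> ennreal" where
  "firings_third_moment lam \<zeta> =
     (\<integral>\<^sup>+ (b, \<rho>). ennreal_of_enat (firings lam \<rho> (config_of b) 0) ^ 3 \<partial>joint_measure lam \<zeta>)"

text \<open>Inserting \<open>0\<close> implements the convention that the supremum of the empty set is \<open>0\<close>.\<close>

definition outer_density :: "ereal \<Rightarrow> real" where
  "outer_density lam =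
     Sup (insert 0 {\<zeta>. 0 < \<zeta> \<and> \<zeta> < 1 \<and> firings_third_moment lam \<zeta> < \<infinity>})"

definition num_sleeping :: "config \<Rightarrow> nat" where
  "num_sleeping \<eta> = card {x. \<eta> x = Asleep}"

definition inner_density_on :: "ereal \<Rightarrow> int set \<Rightarrow> real" where
  "inner_density_on lam I =
     Inf {\<zeta>. 0 < \<zeta> \<and>
       \<P>(\<rho> in stack_measure lam.
           real (num_sleeping (stabilization lam I \<rho> (config_of (\<lambda>x. x \<in> I)))) > \<zeta> * real (card I))
         \<le> 1 / real (card I) ^ 20}"

definition large_intervals :: "int set filter" where
  "large_intervals = inf (filtercomap card at_top) (principal {{a..b} | a b. a \<le> b})"

lemma eventually_large_intervals:
  "eventually P large_intervals \<longleftrightarrow>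
     (\<exists>n. \<forall>a b. a \<le> b \<longrightarrow> n \<le> card {a..b} \<longrightarrow> P {a..b})"
  unfolding large_intervals_def eventually_inf_principal eventually_filtercomap_at_top_linorder
  by blast

lemma large_intervals_neq_bot: "large_intervals \<noteq> bot"
proof
  assume "large_intervals = bot"
  then have "eventually (\<lambda>_. False) large_intervals" by simp
  then obtain n where n: "\<And>a b :: int. a \<le> b \<Longrightarrow> \<not> n \<le> card {a..b}"
    unfolding eventually_large_intervals by blast
  show False using n[of 0 "int n"] by simp
qed

definition inner_density :: "ereal \<Rightarrow> ereal" where
  "inner_density lam = Limsup large_intervals (\<lambda>I. ereal (inner_density_on lam I))"

end

theory Submission
  imports Defs
begin

text \<open>For a finite sleep rate, describe a state by its odometer: the number of particles at each site is a
  conservation law in the odometer, and a particle is asleep iff it is alone and the last instruction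
  used at its site is \<open>Doze\<close>. The least action principle bounds every legal odometer by any stabilizing
  one, so a stabilizing odometer, however it is found, bounds the number of surviving particles from
  below.

  Firings that wake sleeping particles are therefore allowed, and an extra particle put into \<open>I\<close> can be
  walked out of \<open>I\<close>, after which the rest evolves with independent stacks. In one-step form: the
  probability of retaining \<open>c\<close> particles is superharmonic in the position of the extra particle. Hence a
  full interval stochastically retains at least as many particles as a Bernoulli sample.
  The latter loses at most \<open>w(a) + w(b)\<close> particles through the end points, whose expectation is bounded
  uniformly in \<open>I = {a..b}\<close>. So a positive density below \<open>\<zeta>\<close> survives with probability bounded away
  from \<open>0\<close>. At infinite sleep rate the full interval is already stable.\<close>

subsection \<open>Odometers and least action\<close>

definition jumps :: "instr \<Rightarrow> stacks \<Rightarrow> int \<Rightarrow> nat \<Rightarrow> int" where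
  "jumps i \<rho> x k = (\<Sum>j<k. of_bool (\<rho> (x, j) = i))"

text \<open>A signed count, since an odometer that comes from no legal firings may send out more
  particles than a site has received. Dropping arrivals outside \<open>D\<close> encodes the removal
  of particles that leave \<open>D\<close>.\<close>

definition net :: "int set \<Rightarrow> (int \<Rightarrow> nat) \<Rightarrow> stacks \<Rightarrow> (int \<Rightarrow> nat) \<Rightarrow> int \<Rightarrow> int" where
  "net D n \<rho> u x = int (n x)
     + (if x \<in> D then jumps GoRight \<rho> (x - 1) (u (x - 1)) + jumps GoLeft \<rho> (x + 1) (u (x + 1)) else 0)
     - jumps GoLeft \<rho> x (u x) - jumps GoRight \<rho> x (u x)"

definition dozed :: "stacks \<Rightarrow> (int \<Rightarrow> nat) \<Rightarrow> int \<Rightarrow> bool" where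
  "dozed \<rho> u x \<longleftrightarrow> 0 < u x \<and> \<rho> (x, u x - 1) = Doze"

text \<open>The last instruction alone decides about sleep: a site loses a particle only by a jump
  from it, which overwrites that instruction. So a crowded site where \<open>Doze\<close> had no
  effect cannot come down to one particle and still be read as asleep.\<close>

definition config_at :: "int set \<Rightarrow> (int \<Rightarrow> nat) \<Rightarrow> stacks \<Rightarrow> (int \<Rightarrow> nat) \<Rightarrow> config" where
  "config_at D n \<rho> u x =
     (if net D n \<rho> u x = 1 \<and> dozed \<rho> u x then Asleep else Awake (nat (net D n \<rho> u x)))"

definition fireable :: "int set \<Rightarrow> (int \<Rightarrow> nat) \<Rightarrow> stacks \<Rightarrow> (int \<Rightarrow> nat) \<Rightarrow> int \<Rightarrow> bool" where
  "fireable D n \<rho> u x \<longleftrightarrow> 1 \<le> net D n \<rho> u x \<and> \<not> (net D n \<rho> u x = 1 \<and> dozed \<rho> u x)"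

text \<open>The invariant of odometers reached legally. The second clause excludes an empty site
  whose last instruction was \<open>Doze\<close>; a particle arriving there would wrongly be read as
  asleep.\<close>

definition realizable :: "int set \<Rightarrow> (int \<Rightarrow> nat) \<Rightarrow> stacks \<Rightarrow> (int \<Rightarrow> nat) \<Rightarrow> bool" where
  "realizable D n \<rho> u \<longleftrightarrow> (\<forall>x. 0 \<le> net D n \<rho> u x \<and> (dozed \<rho> u x \<longrightarrow> 1 \<le> net D n \<rho> u x))"

primrec legal_odo :: "int set \<Rightarrow> (int \<Rightarrow> nat) \<Rightarrow> stacks \<Rightarrow> int list \<Rightarrow> (int \<Rightarrow> nat) \<Rightarrow> bool" where
  "legal_odo D n \<rho> [] u \<longleftrightarrow> True"
| "legal_odo D n \<rho> (x # xs) u \<longleftrightarrow> fireable D n \<rho> u x \<and> legal_odo D n \<rho> xs (u(x := u x + 1))"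

definition stabilizing :: "int set \<Rightarrow> (int \<Rightarrow> nat) \<Rightarrow> stacks \<Rightarrow> (int \<Rightarrow> nat) \<Rightarrow> bool" where
  "stabilizing D n \<rho> u \<longleftrightarrow> (\<forall>x. x \<notin> D \<longrightarrow> u x = 0) \<and>
     (\<forall>x\<in>D. net D n \<rho> u x \<le> 1 \<and> (net D n \<rho> u x = 1 \<longrightarrow> dozed \<rho> u x))"

lemma jumps_0 [simp]: "jumps i \<rho> x 0 = 0"
  by (simp add: jumps_def)

lemma jumps_Suc: "jumps i \<rho> x (Suc k) = jumps i \<rho> x k + of_bool (\<rho> (x, k) = i)"
  by (simp add: jumps_def)

lemma jumps_mono: "k \<le> l \<Longrightarrow> jumps i \<rho> x k \<le> jumps i \<rho> x l"
  unfolding jumps_def by (intro sum_mono2) auto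

lemma jumps_nonneg: "0 \<le> jumps i \<rho> x k"
  by (simp add: jumps_def sum_nonneg)

lemma jumps_le: "jumps i \<rho> x k \<le> int k"
  using sum_mono[of "{..<k}" "\<lambda>j. of_bool (\<rho> (x, j) = i)" "\<lambda>_. 1 :: int"]
  by (simp add: jumps_def)

lemma net_fire:
  "net D n \<rho> (u(x := u x + 1)) z = net D n \<rho> u z
     + of_bool (z \<in> D \<and> (z = x + 1 \<and> \<rho> (x, u x) = GoRight \<or> z = x - 1 \<and> \<rho> (x, u x) = GoLeft))
     - of_bool (z = x \<and> \<rho> (x, u x) \<noteq> Doze)"
  by (cases "\<rho> (x, u x)") (auto simp: net_def jumps_Suc)

lemma dozed_fire:
  "dozed \<rho> (u(x := u x + 1)) z \<longleftrightarrow> (if z = x then \<rho> (x, u x) = Doze else dozed \<rho> u z)"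
  by (simp add: dozed_def)

section \<open>From configurations to odometers\<close>

lemma active_config_at: "active (config_at D n \<rho> u x) \<longleftrightarrow> fireable D n \<rho> u x"
  by (auto simp: config_at_def fireable_def)

lemma realizable_fire:
  assumes "realizable D n \<rho> u" "fireable D n \<rho> u x"
  shows "realizable D n \<rho> (u(x := u x + 1))"
  unfolding realizable_def
proof
  fix z
  have "0 \<le> net D n \<rho> u z" "dozed \<rho> u z \<longrightarrow> 1 \<le> net D n \<rho> u z"
    using assms(1) by (auto simp: realizable_def)
  moreover have "1 \<le> net D n \<rho> u x"
    using assms(2) by (auto simp: fireable_def)
  ultimately show "0 \<le> net D n \<rho> (u(x := u x + 1)) z \<and>
      (dozed \<rho> (u(x := u x + 1)) z \<longrightarrow> 1 \<le> net D n \<rho> (u(x := u x + 1)) z)"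
    unfolding net_fire dozed_fire by (cases "z = x") auto
qed

lemma fire_config_at:
  assumes "lam \<noteq> \<infinity>" "realizable D n \<rho> u" "fireable D n \<rho> u x"
  shows "fire lam D \<rho> x (config_at D n \<rho> u, u) =
    (config_at D n \<rho> (u(x := u x + 1)), u(x := u x + 1))"
proof -
  have "apply_instr D (\<rho> (x, u x)) x (config_at D n \<rho> u) z = config_at D n \<rho> (u(x := u x + 1)) z" for z
  proof -
    have "0 \<le> net D n \<rho> u z" "dozed \<rho> u z \<longrightarrow> 1 \<le> net D n \<rho> u z"
      using assms(2) by (auto simp: realizable_def)
    moreover have "1 \<le> net D n \<rho> u x" "\<not> (net D n \<rho> u x = 1 \<and> dozed \<rho> u x)"
      using assms(3) by (auto simp: fireable_def)
    ultimately show ?thesis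
      unfolding config_at_def net_fire dozed_fire
      by (cases "\<rho> (x, u x)")
        (auto simp: move_def fall_asleep_def config_at_def Let_def nat_add_distrib nat_diff_distrib)
  qed
  then show ?thesis
    using assms(1) by (auto simp: settle_def fun_eq_iff)
qed

definition counts :: "int list \<Rightarrow> int \<Rightarrow> nat" where
  "counts xs = (\<lambda>x. count_list xs x)"

text \<open>The induction rests on the fact that one legal firing preserves realizability and
  commutes with reading off the configuration. From here on the dynamics at a finite sleep rate is
  studied through odometers alone.\<close>

lemma legal_run_config_at:
  assumes "lam \<noteq> \<infinity>" "realizable D n \<rho> u"
  shows "legal lam D \<rho> xs (config_at D n \<rho> u, u) \<longleftrightarrow> legal_odo D n \<rho> xs u"
    and "legal_odo D n \<rho> xs u \<Longrightarrow> run lam D \<rho> xs (config_at D n \<rho> u, u) =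
      (config_at D n \<rho> (\<lambda>z. u z + counts xs z), \<lambda>z. u z + counts xs z)"
    and "legal_odo D n \<rho> xs u \<Longrightarrow> realizable D n \<rho> (\<lambda>z. u z + counts xs z)"
  using assms(2)
proof (induction xs arbitrary: u)
  case Nil
  { case 1 show ?case by simp next case 2 then show ?case by (simp add: counts_def)
    next case 3 then show ?case by (simp add: counts_def) }
next
  case (Cons x xs)
  have eq: "(\<lambda>z. (u(x := u x + 1)) z + counts xs z) = (\<lambda>z. u z + counts (x # xs) z)" for u
    by (auto simp: counts_def)
  { case 1
    show ?case
    proof (cases "fireable D n \<rho> u x")
      case True
      then show ?thesis
        using Cons.IH(1)[OF realizable_fire[OF 1 True]]
        by (simp add: active_config_at fire_config_at[OF assms(1) 1 True] del: fire.simps fun_upd_apply)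
    qed (simp add: active_config_at)
  next
    case 2
    then have f: "fireable D n \<rho> u x" and l: "legal_odo D n \<rho> xs (u(x := u x + 1))"
      by auto
    show ?case
      using Cons.IH(2)[OF l realizable_fire[OF 2(2) f]] unfolding eq
      by (simp add: fire_config_at[OF assms(1) 2(2) f] del: fire.simps fun_upd_apply)
  next
    case 3
    then have f: "fireable D n \<rho> u x" and l: "legal_odo D n \<rho> xs (u(x := u x + 1))"
      by auto
    show ?case
      using Cons.IH(3)[OF l realizable_fire[OF 3(2) f]] unfolding eq . }
qed

lemma config_at_0: "config_at D n \<rho> (\<lambda>_. 0) = (\<lambda>x. Awake (n x))"
  by (auto simp: config_at_def dozed_def net_def)

lemma realizable_0: "realizable D n \<rho> (\<lambda>_. 0)"
  by (auto simp: realizable_def dozed_def net_def)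

definition occ :: "(int \<Rightarrow> bool) \<Rightarrow> int \<Rightarrow> nat" where
  "occ b = (\<lambda>x. of_bool (b x))"

lemma init_config_of: "lam \<noteq> \<infinity> \<Longrightarrow> init lam (config_of b) = (config_at D (occ b) \<rho> (\<lambda>_. 0), \<lambda>_. 0)"
  by (auto simp: init_def settle_def config_at_0 config_of_def occ_def fun_eq_iff)

lemma legal_init:
  assumes "lam \<noteq> \<infinity>"
  shows "legal lam D \<rho> xs (init lam (config_of b)) \<longleftrightarrow> legal_odo D (occ b) \<rho> xs (\<lambda>_. 0)"
    and "legal_odo D (occ b) \<rho> xs (\<lambda>_. 0) \<Longrightarrow>
      fst (run lam D \<rho> xs (init lam (config_of b))) = config_at D (occ b) \<rho> (counts xs)"
  using legal_run_config_at[OF assms realizable_0[of D "occ b" \<rho>], of xs]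
  by (simp_all add: init_config_of[OF assms, of b D \<rho>])

text \<open>To exceed \<open>u\<close> for the first time, the legal sequence would have to fire a
  site \<open>y\<close> with \<open>v y = u y\<close>. The other sites have fired at most as often
  as under \<open>u\<close>, so \<open>y\<close> has received no more particles and sent out equally
  many; since \<open>u\<close> is stabilizing, \<open>y\<close> is not fireable.\<close>

lemma least_action:
  assumes "stabilizing D n \<rho> u" "legal_odo D n \<rho> xs v" "\<And>x. v x \<le> u x" "\<And>x. x \<notin> D \<Longrightarrow> n x = 0"
  shows "v x + counts xs x \<le> u x"
  using assms(2,3)
proof (induction xs arbitrary: v)
  case Nil
  then show ?case by (simp add: counts_def)
next
  case (Cons y ys)
  have f: "fireable D n \<rho> v y" using Cons.prems by simp
  have "y \<in> D"
  proof (rule ccontr)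
    assume "y \<notin> D"
    then have "net D n \<rho> v y \<le> 0"
      using assms(4) jumps_nonneg[of GoLeft \<rho> y "v y"] jumps_nonneg[of GoRight \<rho> y "v y"]
      by (simp add: net_def)
    then show False using f by (simp add: fireable_def)
  qed
  have "v y \<noteq> u y"
  proof
    assume eq: "v y = u y"
    have "net D n \<rho> v y \<le> net D n \<rho> u y"
      unfolding net_def eq using Cons.prems(2) by (auto intro!: add_mono jumps_mono)
    moreover have "dozed \<rho> v y = dozed \<rho> u y" by (simp add: dozed_def eq)
    ultimately show False
      using f assms(1) \<open>y \<in> D\<close> by (fastforce simp: fireable_def stabilizing_def)
  qed
  then have "(v(y := v y + 1)) x \<le> u x" for x
    using Cons.prems(2)[of x] by (auto simp: Suc_le_eq order.strict_iff_order)
  then have "(v(y := v y + 1)) x + counts ys x \<le> u x"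
    using Cons.prems(1) by (intro Cons.IH) (simp_all del: fun_upd_apply)
  then show ?case by (auto simp: counts_def split: if_splits)
qed

section \<open>Halting sequences and the stabilization\<close>

lemma stable_iff: "stable \<eta> \<longleftrightarrow> (\<forall>x. \<not> active (\<eta> x))"
proof -
  have "c \<in> {Awake 0, Asleep} \<longleftrightarrow> \<not> active c" for c
    by (cases c) auto
  then show ?thesis by (simp add: stable_def)
qed

lemma legal_odo_append:
  "legal_odo D n \<rho> (xs @ ys) u \<longleftrightarrow>
    legal_odo D n \<rho> xs u \<and> legal_odo D n \<rho> ys (\<lambda>z. u z + counts xs z)"
proof (induction xs arbitrary: u)
  case (Cons x xs)
  have "(\<lambda>z. (u(x := u x + 1)) z + counts xs z) = (\<lambda>z. u z + counts (x # xs) z)"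
    by (auto simp: counts_def)
  then show ?case using Cons[of "u(x := u x + 1)"] by (simp del: fun_upd_apply)
qed (simp add: counts_def)

lemma legal_odo_subset:
  assumes "legal_odo D n \<rho> xs u" "\<And>x. x \<notin> D \<Longrightarrow> n x = 0"
  shows "set xs \<subseteq> D"
  using assms(1)
proof (induction xs arbitrary: u)
  case (Cons y ys)
  have "y \<in> D"
  proof (rule ccontr)
    assume "y \<notin> D"
    then have "net D n \<rho> u y \<le> 0"
      using assms(2) jumps_nonneg[of GoLeft \<rho> y "u y"] jumps_nonneg[of GoRight \<rho> y "u y"]
      by (simp add: net_def)
    then show False using Cons by (simp add: fireable_def)
  qed
  then show ?case using Cons by auto
qed simp

definition halts :: "int set \<Rightarrow> (int \<Rightarrow> nat) \<Rightarrow> stacks \<Rightarrow> int list \<Rightarrow> bool" where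
  "halts D n \<rho> xs \<longleftrightarrow> legal_odo D n \<rho> xs (\<lambda>_. 0) \<and> (\<forall>x. \<not> fireable D n \<rho> (counts xs) x)"

lemma halts_stabilizing:
  assumes "halts D n \<rho> xs" "\<And>x. x \<notin> D \<Longrightarrow> n x = 0"
  shows "stabilizing D n \<rho> (counts xs)"
proof -
  have l: "legal_odo D n \<rho> xs (\<lambda>_. 0)" using assms(1) by (simp add: halts_def)
  have "set xs \<subseteq> D" by (rule legal_odo_subset[OF l assms(2)])
  then have "counts xs x = 0" if "x \<notin> D" for x
    using that by (auto simp: counts_def count_list_0_iff)
  moreover have "\<not> fireable D n \<rho> (counts xs) x" for x using assms(1) by (simp add: halts_def)
  ultimately show ?thesis
    unfolding stabilizing_def fireable_def by (metis linorder_linear order.eq_iff)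
qed

text \<open>Bounds on the firings at each site of a finite \<open>D\<close> bound the length of
  legal sequences; a longest one cannot be extended, so it halts. The bound \<open>f\<close> will
  come from a stabilizing odometer or from the firings on the line.\<close>

lemma halts_exists:
  assumes "finite D" "\<And>x. x \<notin> D \<Longrightarrow> n x = 0"
    and "\<And>xs x. legal_odo D n \<rho> xs (\<lambda>_. 0) \<Longrightarrow> x \<in> D \<Longrightarrow> counts xs x \<le> f x"
  shows "\<exists>xs. halts D n \<rho> xs"
proof -
  have "length xs \<le> sum f D" if l: "legal_odo D n \<rho> xs (\<lambda>_. 0)" for xs
  proof -
    have "length xs = (\<Sum>x\<in>D. counts xs x)"
      unfolding counts_def
      using sum_count_set[OF legal_odo_subset[OF l assms(2)] assms(1)] by simp
    also have "\<dots> \<le> sum f D" using assms(3)[OF l] by (intro sum_mono) auto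
    finally show ?thesis .
  qed
  then obtain xs where xs: "legal_odo D n \<rho> xs (\<lambda>_. 0)"
    and max: "\<And>ys. legal_odo D n \<rho> ys (\<lambda>_. 0) \<Longrightarrow> length ys \<le> length xs"
    using ex_has_greatest_nat[of "\<lambda>xs. legal_odo D n \<rho> xs (\<lambda>_. 0)" "[]" length "Suc (sum f D)"]
    by (auto simp: less_Suc_eq_le)
  have "\<not> fireable D n \<rho> (counts xs) x" for x
  proof
    assume "fireable D n \<rho> (counts xs) x"
    then have "legal_odo D n \<rho> (xs @ [x]) (\<lambda>_. 0)"
      using xs by (simp add: legal_odo_append)
    from max[OF this] show False by simp
  qed
  then show ?thesis using xs by (auto simp: halts_def)
qed

lemma halts_iff:
  assumes "lam \<noteq> \<infinity>"
  shows "halts D (occ b) \<rho> xs \<longleftrightarrow> legal lam D \<rho> xs (init lam (config_of b)) \<and>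
    stable (fst (run lam D \<rho> xs (init lam (config_of b))))"
  using legal_init[OF assms, where D = D and \<rho> = \<rho> and xs = xs and b = b]
  by (auto simp: halts_def stable_iff active_config_at)

text \<open>By the least action principle two halting sequences have the same odometer, which determines
  the configuration.\<close>

lemma stabilization_eq:
  assumes "lam \<noteq> \<infinity>" "halts D (occ b) \<rho> xs" "\<And>x. x \<notin> D \<Longrightarrow> \<not> b x"
  shows "stabilization lam D \<rho> (config_of b) = config_at D (occ b) \<rho> (counts xs)"
proof -
  have z: "occ b x = 0" if "x \<notin> D" for x using assms(3) that by (simp add: occ_def)
  have le: "counts ys x \<le> counts zs x"
    if "halts D (occ b) \<rho> ys" "halts D (occ b) \<rho> zs" for ys zs x
    using least_action[OF halts_stabilizing[OF that(2) z], of ys "\<lambda>_. 0" x] that(1) z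
    by (auto simp: halts_def)
  have uniq: "counts ys = counts xs" if "halts D (occ b) \<rho> ys" for ys
    using le[OF that assms(2)] le[OF assms(2) that] by (auto simp: fun_eq_iff intro: antisym)
  show ?thesis
    unfolding stabilization_def
  proof (rule the_equality)
    show "\<exists>xs'. legal lam D \<rho> xs' (init lam (config_of b)) \<and>
       config_at D (occ b) \<rho> (counts xs) = fst (run lam D \<rho> xs' (init lam (config_of b))) \<and>
       stable (config_at D (occ b) \<rho> (counts xs))"
      using assms(2) halts_iff[OF assms(1), of D b \<rho> xs] legal_init[OF assms(1), where D = D and \<rho> = \<rho> and xs = xs and b = b]
      by metis
  next
    fix \<eta>'
    assume "\<exists>ys. legal lam D \<rho> ys (init lam (config_of b)) \<and>
       \<eta>' = fst (run lam D \<rho> ys (init lam (config_of b))) \<and> stable \<eta>'"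
    then obtain ys where "legal lam D \<rho> ys (init lam (config_of b))"
      "\<eta>' = fst (run lam D \<rho> ys (init lam (config_of b)))" "stable \<eta>'" by blast
    then show "\<eta>' = config_at D (occ b) \<rho> (counts xs)"
      using uniq halts_iff[OF assms(1), of D b \<rho> ys] legal_init[OF assms(1), where D = D and \<rho> = \<rho> and xs = ys and b = b] by metis
  qed
qed

text \<open>Without a halting sequence the stabilization is one unspecified value that does not
  depend on the stacks. This keeps events about it measurable and its particle number bounded
  without proving that a halting sequence exists almost surely.\<close>

lemma stabilization_none:
  assumes "lam \<noteq> \<infinity>" "\<nexists>xs. halts D (occ b) \<rho> xs"
  shows "stabilization lam D \<rho> (config_of b) = (THE \<eta>. False)"
proof -
  have "(\<lambda>\<eta>'. \<exists>xs. legal lam D \<rho> xs (init lam (config_of b)) \<and>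
       \<eta>' = fst (run lam D \<rho> xs (init lam (config_of b))) \<and> stable \<eta>') = (\<lambda>_. False)"
    using assms(2) halts_iff[OF assms(1), of D b \<rho>] by auto
  then show ?thesis unfolding stabilization_def by simp
qed

text \<open>At a halting odometer \<open>net\<close> is 0 or 1 on \<open>D\<close>, and 1 exactly at
  sleeping particles, so it is their indicator. Sites outside \<open>D\<close> have not fired and
  hold no sleeper.\<close>

lemma num_sleeping_config_at:
  assumes "finite D" "halts D n \<rho> xs" "\<And>x. x \<notin> D \<Longrightarrow> n x = 0"
  shows "int (num_sleeping (config_at D n \<rho> (counts xs))) = (\<Sum>x\<in>D. net D n \<rho> (counts xs) x)"
proof -
  let ?u = "counts xs"
  have st: "stabilizing D n \<rho> ?u" by (rule halts_stabilizing[OF assms(2,3)])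
  \<comment> \<open>The statement about realizability does not involve the sleep rate; 0 serves as
    an arbitrary finite one.\<close>
  have "realizable D n \<rho> ?u"
    using legal_run_config_at(3)[of 0 D n \<rho> "\<lambda>_. 0" xs] realizable_0 assms(2)
    by (simp add: halts_def)
  then have net: "net D n \<rho> ?u x = of_bool (config_at D n \<rho> ?u x = Asleep)" if "x \<in> D" for x
    using st that unfolding realizable_def stabilizing_def config_at_def
    by (smt (verit) content.distinct(1) of_bool_eq)
  have out: "config_at D n \<rho> ?u x \<noteq> Asleep" if "x \<notin> D" for x
    using st assms(3) that by (auto simp: config_at_def stabilizing_def dozed_def)
  have "(\<Sum>x\<in>D. net D n \<rho> ?u x) = (\<Sum>x\<in>D. of_bool (config_at D n \<rho> ?u x = Asleep))"
    using net by (intro sum.cong) auto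
  also have "\<dots> = int (card (D \<inter> {x. config_at D n \<rho> ?u x = Asleep}))"
    using assms(1) by (simp add: of_bool_def sum.If_cases)
  also have "D \<inter> {x. config_at D n \<rho> ?u x = Asleep} = {x. config_at D n \<rho> ?u x = Asleep}"
    using out by auto
  finally show ?thesis by (simp add: num_sleeping_def)
qed

section \<open>Conservation of particles in an interval\<close>

lemma telescope_int:
  fixes f :: "int \<Rightarrow> int"
  assumes "a \<le> b"
  shows "(\<Sum>x\<in>{a..b}. f (x - 1) - f x) = f (a - 1) - f b"
  using assms
proof (induction b rule: int_ge_induct)
  case (step i)
  have "{a..i + 1} = insert (i + 1) {a..i}" using step by auto
  then show ?case using step by simp
qed simp

text \<open>Jumps between sites of the interval cancel in the sum. What is left are the jumps to the
  left from \<open>a\<close> and to the right from \<open>b\<close>; nothing enters, as the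
  neighbouring sites do not fire.\<close>

lemma sum_net:
  assumes "a \<le> b" "\<And>x. x \<notin> {a..b} \<Longrightarrow> u x = 0"
  shows "(\<Sum>x\<in>{a..b}. net {a..b} n \<rho> u x) =
    int (\<Sum>x\<in>{a..b}. n x) - jumps GoLeft \<rho> a (u a) - jumps GoRight \<rho> b (u b)"
proof -
  \<comment> \<open>The sign and the shift in \<open>?L\<close> make the left jumps telescope in the
    same direction as the right jumps.\<close>
  let ?R = "\<lambda>x. jumps GoRight \<rho> x (u x)" and ?L = "\<lambda>x. - jumps GoLeft \<rho> (x + 1) (u (x + 1))"
  have "(\<Sum>x\<in>{a..b}. net {a..b} n \<rho> u x) =
     (\<Sum>x\<in>{a..b}. int (n x) + ((?R (x - 1) - ?R x) + (?L (x - 1) - ?L x)))"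
    by (intro sum.cong) (auto simp: net_def)
  also have "\<dots> = int (\<Sum>x\<in>{a..b}. n x) + ((?R (a - 1) - ?R b) + (?L (a - 1) - ?L b))"
    using telescope_int[OF assms(1), of ?R] telescope_int[OF assms(1), of ?L]
    by (simp only: sum.distrib of_nat_sum)
  finally show ?thesis using assms(2)[of "a - 1"] assms(2)[of "b + 1"] by simp
qed

subsection \<open>Particles retained by an interval\<close>

lemma space_stack_measure [simp]: "space (stack_measure lam) = UNIV"
  by (simp add: stack_measure_def space_PiM PiE_UNIV_domain)

lemma prob_space_stack_measure: "prob_space (stack_measure lam)"
  unfolding stack_measure_def by (intro prob_space_PiM prob_space_measure_pmf)

lemma measurable_stack_component [measurable]:
  "(\<lambda>\<rho>. \<rho> i) \<in> stack_measure lam \<rightarrow>\<^sub>M count_space UNIV"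
proof -
  have "(\<lambda>\<rho>. \<rho> i) \<in> stack_measure lam \<rightarrow>\<^sub>M measure_pmf (instr_pmf lam)"
    unfolding stack_measure_def by measurable
  then show ?thesis by (simp cong: measurable_cong_sets)
qed

lemma space_bernoulli_measure [simp]: "space (bernoulli_measure \<zeta>) = UNIV"
  by (simp add: bernoulli_measure_def space_PiM PiE_UNIV_domain)

lemma prob_space_bernoulli_measure: "prob_space (bernoulli_measure \<zeta>)"
  unfolding bernoulli_measure_def by (intro prob_space_PiM prob_space_measure_pmf)

lemma measurable_bernoulli_component [measurable]:
  "(\<lambda>\<beta>. \<beta> x) \<in> bernoulli_measure \<zeta> \<rightarrow>\<^sub>M count_space UNIV"
proof -
  have "(\<lambda>\<beta>. \<beta> x) \<in> bernoulli_measure \<zeta> \<rightarrow>\<^sub>M measure_pmf (bernoulli_pmf \<zeta>)"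
    unfolding bernoulli_measure_def by measurable
  then show ?thesis by (simp cong: measurable_cong_sets)
qed

section \<open>Measurability for random particle numbers and random stacks\<close>

context
  fixes M :: "'w measure" and n :: "'w \<Rightarrow> int \<Rightarrow> nat" and \<rho> :: "'w \<Rightarrow> stacks"
  assumes n [measurable]: "\<And>x. (\<lambda>\<omega>. n \<omega> x) \<in> M \<rightarrow>\<^sub>M count_space UNIV"
    and \<rho> [measurable]: "\<And>i. (\<lambda>\<omega>. \<rho> \<omega> i) \<in> M \<rightarrow>\<^sub>M count_space UNIV"
begin

lemma measurable_jumps: "(\<lambda>\<omega>. real_of_int (jumps i (\<rho> \<omega>) x k)) \<in> borel_measurable M"
  unfolding jumps_def of_int_sum of_int_of_bool of_bool_def by measurable

lemma measurable_net: "(\<lambda>\<omega>. real_of_int (net D (n \<omega>) (\<rho> \<omega>) u x)) \<in> borel_measurable M"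
proof -
  have [measurable]: "(\<lambda>\<omega>. real (n \<omega> x)) \<in> borel_measurable M" by measurable
  note measurable_jumps [measurable]
  show ?thesis unfolding net_def by (cases "x \<in> D"; simp; measurable)
qed

lemma measurable_sum_net: "(\<lambda>\<omega>. real_of_int (\<Sum>x\<in>E. net D (n \<omega>) (\<rho> \<omega>) u x)) \<in> borel_measurable M"
  using measurable_net by (simp add: borel_measurable_sum)

lemma pred_net:
  "Measurable.pred M (\<lambda>\<omega>. net D (n \<omega>) (\<rho> \<omega>) u x = k)"
  "Measurable.pred M (\<lambda>\<omega>. net D (n \<omega>) (\<rho> \<omega>) u x \<le> k)"
  "Measurable.pred M (\<lambda>\<omega>. k \<le> net D (n \<omega>) (\<rho> \<omega>) u x)"
proof -
  note measurable_net [measurable]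
  have "Measurable.pred M (\<lambda>\<omega>. real_of_int (net D (n \<omega>) (\<rho> \<omega>) u x) = real_of_int k)"
    "Measurable.pred M (\<lambda>\<omega>. real_of_int (net D (n \<omega>) (\<rho> \<omega>) u x) \<le> real_of_int k)"
    "Measurable.pred M (\<lambda>\<omega>. real_of_int k \<le> real_of_int (net D (n \<omega>) (\<rho> \<omega>) u x))"
    by measurable
  then show "Measurable.pred M (\<lambda>\<omega>. net D (n \<omega>) (\<rho> \<omega>) u x = k)"
    "Measurable.pred M (\<lambda>\<omega>. net D (n \<omega>) (\<rho> \<omega>) u x \<le> k)"
    "Measurable.pred M (\<lambda>\<omega>. k \<le> net D (n \<omega>) (\<rho> \<omega>) u x)"
    by simp_all
qed

lemma pred_dozed: "Measurable.pred M (\<lambda>\<omega>. dozed (\<rho> \<omega>) u x)"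
  unfolding dozed_def by measurable

lemma pred_fireable: "Measurable.pred M (\<lambda>\<omega>. fireable D (n \<omega>) (\<rho> \<omega>) u x)"
proof -
  note pred_net [measurable] pred_dozed [measurable]
  show ?thesis unfolding fireable_def by measurable
qed

lemma pred_legal_odo: "Measurable.pred M (\<lambda>\<omega>. legal_odo D (n \<omega>) (\<rho> \<omega>) xs u)"
proof (induction xs arbitrary: u)
  case (Cons x xs)
  note Cons [measurable] pred_fireable [measurable]
  show ?case unfolding legal_odo.simps by measurable
qed simp

lemma pred_halts: "Measurable.pred M (\<lambda>\<omega>. halts D (n \<omega>) (\<rho> \<omega>) xs)"
proof -
  note pred_legal_odo [measurable] pred_fireable [measurable]
  show ?thesis unfolding halts_def by measurable
qed

lemma pred_stabilizing: "Measurable.pred M (\<lambda>\<omega>. stabilizing D (n \<omega>) (\<rho> \<omega>) u)"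
proof -
  note pred_net [measurable] pred_dozed [measurable]
  show ?thesis unfolding stabilizing_def by measurable
qed

end

text \<open>The odometer of a stabilizing list need not come from legal firings, nor from any sequence of
  firings at all.\<close>

definition retains :: "int set \<Rightarrow> (int \<Rightarrow> nat) \<Rightarrow> real \<Rightarrow> stacks \<Rightarrow> bool" where
  "retains D n c \<rho> \<longleftrightarrow>
     (\<exists>xs. stabilizing D n \<rho> (counts xs) \<and> c \<le> real_of_int (\<Sum>x\<in>D. net D n \<rho> (counts xs) x))"

text \<open>The odometers in \<open>retains\<close> are counts of lists, and there are only
  countably many lists, so the existential quantifier is a countable union of events.\<close>

lemma pred_retains:
  assumes "\<And>x. (\<lambda>\<omega>. n \<omega> x) \<in> M \<rightarrow>\<^sub>M count_space UNIV" "\<And>i. (\<lambda>\<omega>. \<rho> \<omega> i) \<in> M \<rightarrow>\<^sub>M count_space UNIV"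
  shows "Measurable.pred M (\<lambda>\<omega>. retains D (n \<omega>) c (\<rho> \<omega>))"
proof -
  note measurable_sum_net[OF assms, measurable] pred_stabilizing[OF assms, measurable]
  show ?thesis unfolding retains_def by measurable
qed

lemma sets_retains: "{\<rho>. retains D n c \<rho>} \<in> sets (stack_measure lam)"
  using pred_retains[of "\<lambda>_. n" "stack_measure lam" "\<lambda>\<rho>. \<rho>" D c]
  by (simp add: pred_def)

section \<open>Moving an extra particle: popped stacks and the minimum principle\<close>

definition pop :: "int \<Rightarrow> stacks \<Rightarrow> stacks" where
  "pop y \<rho> = (\<lambda>(z, k). \<rho> (z, if z = y then Suc k else k))"

text \<open>\<open>pop y\<close> never reads the coordinate \<open>(y, 0)\<close>, so it also makes
  sense on the product over the remaining coordinates. Both domains occur in the independence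
  argument below.\<close>

lemma measurable_pop:
  assumes "UNIV - {(y, 0)} \<subseteq> K"
  shows "pop y \<in> PiM K (\<lambda>_. measure_pmf p) \<rightarrow>\<^sub>M PiM UNIV (\<lambda>_. measure_pmf p)"
proof (rule measurable_PiM_single')
  fix i :: "int \<times> nat"
  obtain z k where i: "i = (z, k)" by (cases i)
  have "(z, if z = y then Suc k else k) \<in> K" using assms by auto
  from measurable_component_singleton[OF this, of "\<lambda>_. measure_pmf p"]
  show "(\<lambda>\<rho>. pop y \<rho> i) \<in> PiM K (\<lambda>_. measure_pmf p) \<rightarrow>\<^sub>M measure_pmf p"
    by (simp only: i pop_def prod.case)
qed auto

text \<open>The first instruction at \<open>y\<close> is a single coordinate, while the popped
  stacks depend only on the others; reindexing these along an injection gives back the original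
  product law.\<close>

lemma prob_pop:
  assumes "A \<in> sets (stack_measure lam)"
  shows "measure (stack_measure lam) {\<rho>. \<rho> (y, 0) = i \<and> pop y \<rho> \<in> A} =
    pmf (instr_pmf lam) i * measure (stack_measure lam) A"
proof -
  let ?p = "instr_pmf lam" and ?K = "UNIV - {(y, 0 :: nat)}"
  let ?M = "\<lambda>_ :: int \<times> nat. measure_pmf ?p"
  let ?f = "\<lambda>(z, k). (z, if z = y then Suc k else k)"
  interpret K: prob_space "PiM ?K ?M" by (intro prob_space_PiM prob_space_measure_pmf)
  have ins: "insert (y, 0) ?K = UNIV" by auto
  have M: "distr (measure_pmf ?p \<Otimes>\<^sub>M PiM ?K ?M) (stack_measure lam) (\<lambda>(x, X). X((y, 0) := x)) = stack_measure lam"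
    using distr_pair_PiM_eq_PiM[of ?K ?M "(y, 0)"] unfolding ins stack_measure_def
    by (simp add: prob_space_measure_pmf)
  have m1 [measurable]: "(\<lambda>(x, X). X((y, 0) := x)) \<in> measure_pmf ?p \<Otimes>\<^sub>M PiM ?K ?M \<rightarrow>\<^sub>M stack_measure lam"
    unfolding stack_measure_def
    using measurable_fun_upd[of UNIV ?K "(y, 0)" snd "measure_pmf ?p \<Otimes>\<^sub>M PiM ?K ?M" ?M fst] ins
    by (simp add: case_prod_unfold insert_absorb)
  have eq: "distr (PiM ?K ?M) (stack_measure lam) (pop y) = stack_measure lam"
  proof -
    have "distr (PiM ?K ?M) (PiM UNIV (\<lambda>i. ?M (?f i))) (\<lambda>\<omega>. \<lambda>i\<in>UNIV. \<omega> (?f i)) =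
        PiM UNIV (\<lambda>i. ?M (?f i))"
      by (rule distr_PiM_reindex)
        (auto simp: inj_on_def prob_space_measure_pmf split: if_splits)
    moreover have "(\<lambda>\<omega>. \<lambda>i\<in>UNIV. \<omega> (?f i)) = pop y"
      by (simp add: pop_def fun_eq_iff)
    ultimately show ?thesis by (simp only: stack_measure_def)
  qed
  have m2 [measurable]: "pop y \<in> PiM ?K ?M \<rightarrow>\<^sub>M stack_measure lam"
    unfolding stack_measure_def by (rule measurable_pop) auto
  have m3 [measurable]: "pop y \<in> stack_measure lam \<rightarrow>\<^sub>M stack_measure lam"
    unfolding stack_measure_def by (rule measurable_pop) auto
  note assms [measurable]
  let ?S = "{\<rho>. \<rho> (y, 0) = i \<and> pop y \<rho> \<in> A}"
  have S: "?S \<in> sets (stack_measure lam)"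
  proof -
    have "{\<rho> \<in> space (stack_measure lam). \<rho> (y, 0) = i \<and> pop y \<rho> \<in> A} \<in> sets (stack_measure lam)"
      by measurable
    then show ?thesis by simp
  qed
  have "emeasure (stack_measure lam) ?S =
      emeasure (measure_pmf ?p \<Otimes>\<^sub>M PiM ?K ?M)
        ((\<lambda>(x, X). X((y, 0) := x)) -` ?S \<inter> space (measure_pmf ?p \<Otimes>\<^sub>M PiM ?K ?M))"
    by (subst M[symmetric], subst emeasure_distr) (use S in auto)
  also have "(\<lambda>(x, X). X((y, 0) := x)) -` ?S \<inter> space (measure_pmf ?p \<Otimes>\<^sub>M PiM ?K ?M) =
      {i} \<times> (pop y -` A \<inter> space (PiM ?K ?M))"
  proof -
    have "pop y (X((y, 0) := x)) = pop y X" for X x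
      by (auto simp: pop_def)
    then show ?thesis by (auto simp: space_pair_measure)
  qed
  also have "emeasure (measure_pmf ?p \<Otimes>\<^sub>M PiM ?K ?M) \<dots> =
      emeasure (measure_pmf ?p) {i} * emeasure (PiM ?K ?M) (pop y -` A \<inter> space (PiM ?K ?M))"
    by (rule K.emeasure_pair_measure_Times) (auto intro!: measurable_sets[OF m2 assms])
  also have "emeasure (PiM ?K ?M) (pop y -` A \<inter> space (PiM ?K ?M)) = emeasure (stack_measure lam) A"
    using emeasure_distr[OF m2 assms] by (simp only: eq)
  finally show ?thesis
    by (simp add: measure_def enn2real_mult emeasure_pmf_single)
qed

fun target :: "int \<Rightarrow> instr \<Rightarrow> int" where
  "target y GoLeft = y - 1"
| "target y GoRight = y + 1"
| "target y Doze = y"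

lemma jumps_pop: "jumps i (pop y \<rho>) z k =
  (if z = y then jumps i \<rho> z (Suc k) - of_bool (\<rho> (z, 0) = i) else jumps i \<rho> z k)"
proof -
  have "jumps i \<rho> z (Suc k) = of_bool (\<rho> (z, 0) = i) + (\<Sum>j<k. of_bool (\<rho> (z, Suc j) = i))"
    unfolding jumps_def by (rule sum.lessThan_Suc_shift)
  moreover have "jumps i (pop y \<rho>) z k =
      (if z = y then \<Sum>j<k. of_bool (\<rho> (z, Suc j) = i) else jumps i \<rho> z k)"
    unfolding jumps_def pop_def by (cases "z = y") simp_all
  ultimately show ?thesis
    by (cases "z = y") (simp_all only: if_True if_False add_diff_cancel_left')
qed

text \<open>Using up the first instruction at \<open>y\<close> carries the extra particle to its
  target. This is pure counting, so it holds whether or not the firing is legal; a target outside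
  \<open>D\<close> is not seen from within.\<close>

lemma net_pop:
  assumes "y \<in> D" "x \<in> D"
  shows "net D (n(y := n y + 1)) \<rho> (u(y := u y + 1)) x =
    net D (n(target y (\<rho> (y, 0)) := n (target y (\<rho> (y, 0))) + 1)) (pop y \<rho>) u x"
  using assms by (cases "\<rho> (y, 0)") (auto simp: net_def jumps_pop)

lemma retains_pop:
  assumes "y \<in> D"
    and "retains D (n(target y (\<rho> (y, 0)) := n (target y (\<rho> (y, 0))) + 1)) c (pop y \<rho>)"
  shows "retains D (n(y := n y + 1)) c \<rho>"
proof -
  let ?n' = "n(target y (\<rho> (y, 0)) := n (target y (\<rho> (y, 0))) + 1)" and ?n = "n(y := n y + 1)"
  obtain xs where xs: "stabilizing D ?n' (pop y \<rho>) (counts xs)"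
    "c \<le> real_of_int (\<Sum>x\<in>D. net D ?n' (pop y \<rho>) (counts xs) x)"
    using assms(2) unfolding retains_def by blast
  have cy: "counts (y # xs) = (counts xs)(y := counts xs y + 1)"
    by (auto simp: counts_def)
  have net: "net D ?n \<rho> (counts (y # xs)) x = net D ?n' (pop y \<rho>) (counts xs) x" if "x \<in> D" for x
    unfolding cy by (rule net_pop[OF assms(1) that])
  \<comment> \<open>Only this implication is available: if \<open>xs\<close> does not visit
    \<open>y\<close> and the first instruction is \<open>Doze\<close>, then \<open>y\<close> is
    dozed for the original stacks but not for the popped ones.\<close>
  have "dozed \<rho> (counts (y # xs)) x" if "dozed (pop y \<rho>) (counts xs) x" for x
    using that by (auto simp: cy dozed_def pop_def split: if_splits)
  moreover have "counts (y # xs) x = 0" if "x \<notin> D" for x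
    using xs(1) assms(1) that by (auto simp: cy stabilizing_def)
  ultimately have "stabilizing D ?n \<rho> (counts (y # xs))"
    using xs(1) unfolding stabilizing_def by (metis net)
  moreover have "c \<le> real_of_int (\<Sum>x\<in>D. net D ?n \<rho> (counts (y # xs)) x)"
    using xs(2) net by simp
  ultimately show ?thesis unfolding retains_def by blast
qed

text \<open>If the minimum were below \<open>G\<close>, its leftmost location would lie inside
  \<open>{a..b}\<close>. Superharmonicity forces both neighbours to attain it too, and the left one
  contradicts the choice.\<close>

lemma discrete_minimum_principle:
  fixes g :: "int \<Rightarrow> real"
  assumes "\<And>y. y \<in> {a..b} \<Longrightarrow> g (y - 1) + g (y + 1) \<le> 2 * g y"
    and "G \<le> g (a - 1)" "G \<le> g (b + 1)" "y \<in> {a..b}"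
  shows "G \<le> g y"
proof (rule ccontr)
  assume "\<not> G \<le> g y"
  let ?S = "{a - 1..b + 1}"
  define m where "m = Min (g ` ?S)"
  have ne: "g ` ?S \<noteq> {}" using assms(4) by auto
  have le: "m \<le> g z" if "z \<in> ?S" for z using that by (auto simp: m_def)
  have "m < G" using le[of y] assms(4) \<open>\<not> G \<le> g y\<close> by auto
  let ?Z = "{z \<in> ?S. g z = m}"
  have fin: "finite ?Z" by (rule finite_subset[of _ ?S]) auto
  have "m \<in> g ` ?S" unfolding m_def by (rule Min_in) (use ne in auto)
  then have "?Z \<noteq> {}" by auto
  define z where "z = Min ?Z"
  have "z \<in> ?Z" unfolding z_def by (rule Min_in[OF fin \<open>?Z \<noteq> {}\<close>])
  then have z: "z \<in> ?S" "g z = m" by auto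
  have first: "z \<le> w" if "w \<in> ?S" "g w = m" for w
    unfolding z_def by (rule Min_le[OF fin]) (use that in auto)
  have "z \<noteq> a - 1" "z \<noteq> b + 1" using z \<open>m < G\<close> assms(2,3) by auto
  then have "z \<in> {a..b}" using z by auto
  then have "g (z - 1) = m"
    using assms(1)[of z] le[of "z - 1"] le[of "z + 1"] z by auto
  with first[of "z - 1"] \<open>z \<in> {a..b}\<close> show False by auto
qed

lemma pmf_instr:
  assumes "0 < lam" "lam \<noteq> \<infinity>"
  obtains p where "0 < p" "pmf (instr_pmf lam) GoLeft = p" "pmf (instr_pmf lam) GoRight = p"
    "pmf (instr_pmf lam) Doze = 1 - 2 * p"
proof -
  obtain l where l: "lam = ereal l" "0 < l" using assms by (cases lam) auto
  show ?thesis
    by (rule that[of "1 / (2 * (1 + l))"])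
      (use l in \<open>simp_all add: pmf_instr_finite divide_simps\<close>)
qed

text \<open>The probability of retaining \<open>c\<close> particles is superharmonic in the position of an extra
  particle, because moving it by one (possibly illegal) firing leaves independent stacks. Outside the
  interval the extra particle is absent.\<close>

lemma prob_retains_add_one:
  assumes "0 < lam" "lam \<noteq> \<infinity>" "y \<in> {a..b}"
  shows "measure (stack_measure lam) {\<rho>. retains {a..b} n c \<rho>} \<le>
    measure (stack_measure lam) {\<rho>. retains {a..b} (n(y := n y + 1)) c \<rho>}"
proof -
  let ?M = "stack_measure lam"
  interpret prob_space ?M by (rule prob_space_stack_measure)
  define R where "R z = {\<rho>. retains {a..b} (n(z := n z + 1)) c \<rho>}" for z
  have R [measurable]: "R z \<in> sets ?M" for z unfolding R_def by (rule sets_retains)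
  obtain p where p: "0 < p" "pmf (instr_pmf lam) GoLeft = p" "pmf (instr_pmf lam) GoRight = p"
    "pmf (instr_pmf lam) Doze = 1 - 2 * p" using pmf_instr[OF assms(1,2)] .
  have out: "R z = {\<rho>. retains {a..b} n c \<rho>}" if "z \<notin> {a..b}" for z
  proof -
    have "net {a..b} (n(z := n z + 1)) \<rho> u x = net {a..b} n \<rho> u x" if "x \<in> {a..b}" for \<rho> u x
      using that \<open>z \<notin> {a..b}\<close> by (auto simp: net_def)
    then show ?thesis by (simp add: R_def retains_def stabilizing_def cong: conj_cong)
  qed
  have step: "prob (R (z - 1)) + prob (R (z + 1)) \<le> 2 * prob (R z)" if z: "z \<in> {a..b}" for z
  proof -
    \<comment> \<open>The event is split according to the first instruction at
      \<open>z\<close>.\<close>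
    define S where "S i = {\<rho>. \<rho> (z, 0) = i \<and> pop z \<rho> \<in> R (target z i)}" for i
    have S: "prob (S i) = pmf (instr_pmf lam) i * prob (R (target z i))" for i
      unfolding S_def by (rule prob_pop) simp
    have m: "pop z \<in> ?M \<rightarrow>\<^sub>M ?M"
      unfolding stack_measure_def by (rule measurable_pop) auto
    have [measurable]: "S i \<in> sets ?M" for i
    proof -
      note m [measurable]
      have "{\<rho> \<in> space ?M. \<rho> (z, 0) = i \<and> pop z \<rho> \<in> R (target z i)} \<in> sets ?M"
        by measurable
      then show ?thesis by (simp add: S_def)
    qed
    have disj: "disjoint_family_on S {GoLeft, GoRight, Doze}"
      by (auto simp: disjoint_family_on_def S_def)
    have "S i \<subseteq> R z" for i
      using retains_pop[OF z, of n _ c] by (auto simp: S_def R_def)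
    then have "prob (\<Union>i\<in>{GoLeft, GoRight, Doze}. S i) \<le> prob (R z)"
      by (intro finite_measure_mono) auto
    also have "prob (\<Union>i\<in>{GoLeft, GoRight, Doze}. S i) = (\<Sum>i\<in>{GoLeft, GoRight, Doze}. prob (S i))"
      by (intro finite_measure_finite_Union disj) auto
    \<comment> \<open>The contribution of \<open>Doze\<close> is
      \<open>(1 - 2 * p) * prob (R z)\<close>; moved to the right it leaves the factor
      \<open>2 * p\<close>.\<close>
    finally have "p * (prob (R (z - 1)) + prob (R (z + 1))) \<le> p * (2 * prob (R z))"
      by (simp add: S p algebra_simps)
    then show ?thesis using p(1) by simp
  qed
  have "prob {\<rho>. retains {a..b} n c \<rho>} \<le> prob (R y)"
    by (rule discrete_minimum_principle[where a = a and b = b])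
      (use step assms(3) out[of "a - 1"] out[of "b + 1"] in auto)
  then show ?thesis by (simp add: R_def)
qed

text \<open>The vacant sites of the interval are filled one particle at a time, and no step lowers
  the probability.\<close>

lemma prob_retains_le_full:
  assumes "0 < lam" "lam \<noteq> \<infinity>" "B \<subseteq> {a..b}"
  shows "measure (stack_measure lam) {\<rho>. retains {a..b} (occ (\<lambda>x. x \<in> B)) c \<rho>} \<le>
    measure (stack_measure lam) {\<rho>. retains {a..b} (occ (\<lambda>x. x \<in> {a..b})) c \<rho>}"
proof -
  have "measure (stack_measure lam) {\<rho>. retains {a..b} (occ (\<lambda>x. x \<in> B)) c \<rho>} \<le>
    measure (stack_measure lam) {\<rho>. retains {a..b} (occ (\<lambda>x. x \<in> B \<union> C)) c \<rho>}"
    if "C \<subseteq> {a..b} - B" for C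
    using finite_subset[OF that finite_Diff[OF finite_atLeastAtMost_int]] that
  proof (induction C rule: finite_induct)
    case (insert y C)
    have "occ (\<lambda>x. x \<in> B \<union> insert y C) = (occ (\<lambda>x. x \<in> B \<union> C))(y := occ (\<lambda>x. x \<in> B \<union> C) y + 1)"
      using insert.hyps(2) insert.prems by (auto simp: occ_def fun_eq_iff)
    moreover have "y \<in> {a..b}" using insert.prems by auto
    ultimately show ?case
      using insert.IH insert.prems
        prob_retains_add_one[OF assms(1,2), of y a b "occ (\<lambda>x. x \<in> B \<union> C)" c]
      by (simp del: fun_upd_apply Un_iff)
  qed simp
  from this[of "{a..b} - B"] show ?thesis
    using assms(3) by (simp add: Un_absorb1)
qed

text \<open>The stabilizing odometer bounds all legal ones, so a halting sequence exists and its
  odometer is smaller. Fewer firings at the two ends mean fewer jumps out, so at least as many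
  particles survive.\<close>

lemma num_sleeping_ge:
  assumes "lam \<noteq> \<infinity>" "a \<le> b" "\<And>x. \<beta> x \<Longrightarrow> x \<in> {a..b}" "retains {a..b} (occ \<beta>) c \<rho>"
  shows "c \<le> real (num_sleeping (stabilization lam {a..b} \<rho> (config_of \<beta>)))"
proof -
  let ?D = "{a..b}" and ?n = "occ \<beta>"
  obtain ys where st: "stabilizing ?D ?n \<rho> (counts ys)"
    and c: "c \<le> real_of_int (\<Sum>x\<in>?D. net ?D ?n \<rho> (counts ys) x)"
    using assms(4) unfolding retains_def by blast
  have z: "?n x = 0" if "x \<notin> ?D" for x using assms(3) that by (auto simp: occ_def)
  have le: "counts xs x \<le> counts ys x" if "legal_odo ?D ?n \<rho> xs (\<lambda>_. 0)" for xs x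
    using least_action[OF st that _ z, of x] by simp
  obtain xs where xs: "halts ?D ?n \<rho> xs"
    using halts_exists[of ?D ?n \<rho> "counts ys"] z le by auto
  have st': "stabilizing ?D ?n \<rho> (counts xs)" by (rule halts_stabilizing[OF xs z])
  have "(\<Sum>x\<in>?D. net ?D ?n \<rho> (counts ys) x) \<le> (\<Sum>x\<in>?D. net ?D ?n \<rho> (counts xs) x)"
    using st st' le[of xs] xs
    by (subst (1 2) sum_net[OF assms(2)])
      (auto simp: stabilizing_def halts_def intro!: add_mono diff_mono jumps_mono)
  also have "\<dots> = int (num_sleeping (config_at ?D ?n \<rho> (counts xs)))"
    by (rule num_sleeping_config_at[symmetric]) (use xs z in auto)
  also have "config_at ?D ?n \<rho> (counts xs) = stabilization lam ?D \<rho> (config_of \<beta>)"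
    by (rule stabilization_eq[symmetric]) (use assms xs in auto)
  finally show ?thesis using c by linarith
qed

lemma sets_num_sleeping:
  assumes "lam \<noteq> \<infinity>" "finite D" "\<And>x. \<beta> x \<Longrightarrow> x \<in> D"
  shows "{\<rho>. k < real (num_sleeping (stabilization lam D \<rho> (config_of \<beta>)))} \<in> sets (stack_measure lam)"
proof -
  let ?n = "occ \<beta>" and ?d = "num_sleeping (THE \<eta>. False)"
  have z: "?n x = 0" if "x \<notin> D" for x using assms(3) that by (auto simp: occ_def)
  have 1: "num_sleeping (stabilization lam D \<rho> (config_of \<beta>)) = nat (\<Sum>x\<in>D. net D ?n \<rho> (counts xs) x)"
    if "halts D ?n \<rho> xs" for \<rho> xs
    using stabilization_eq[OF assms(1) that] assms(3) num_sleeping_config_at[OF assms(2) that z]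
    by force
  have 2: "num_sleeping (stabilization lam D \<rho> (config_of \<beta>)) = ?d" if "\<nexists>xs. halts D ?n \<rho> xs" for \<rho>
    using stabilization_none[OF assms(1) that] by simp
  \<comment> \<open>The \<open>max 0\<close> is the real form of the truncation by
    \<open>nat\<close>. The second disjunct treats stacks without a halting sequence.\<close>
  have eq: "k < real (num_sleeping (stabilization lam D \<rho> (config_of \<beta>))) \<longleftrightarrow>
    (\<exists>xs. halts D ?n \<rho> xs \<and> k < max 0 (real_of_int (\<Sum>x\<in>D. net D ?n \<rho> (counts xs) x))) \<or>
    (\<not> (\<exists>xs. halts D ?n \<rho> xs) \<and> k < real ?d)" for \<rho>
  proof (cases "\<exists>xs. halts D ?n \<rho> xs")
    case True
    have "real (num_sleeping (stabilization lam D \<rho> (config_of \<beta>))) =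
      max 0 (real_of_int (\<Sum>x\<in>D. net D ?n \<rho> (counts xs) x))" if "halts D ?n \<rho> xs" for xs
      unfolding 1[OF that] by linarith
    with True show ?thesis by metis
  qed (simp add: 2)
  have m: "(\<lambda>\<rho>. ?n x) \<in> stack_measure lam \<rightarrow>\<^sub>M count_space UNIV" for x by simp
  note measurable_sum_net[OF m measurable_stack_component, measurable]
    pred_halts[OF m measurable_stack_component, measurable]
  have "{\<rho> \<in> space (stack_measure lam). (\<exists>xs. halts D ?n \<rho> xs \<and> k < max 0 (real_of_int (\<Sum>x\<in>D. net D ?n \<rho> (counts xs) x))) \<or>
    (\<not> (\<exists>xs. halts D ?n \<rho> xs) \<and> k < real ?d)} \<in> sets (stack_measure lam)"
    by measurable
  then show ?thesis by (simp add: eq)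
qed

subsection \<open>Firings on the line and the two densities\<close>

lemma firings_eq:
  assumes "lam \<noteq> \<infinity>"
  shows "firings lam \<rho> (config_of \<beta>) x =
    (SUP xs \<in> {xs. legal_odo UNIV (occ \<beta>) \<rho> xs (\<lambda>_. 0)}. enat (counts xs x))"
  unfolding firings_def counts_def legal_init(1)[OF assms] ..

text \<open>The supremum over a random set of lists becomes one over all lists, with value 0 for
  those that are not legal. As a countable supremum it is measurable.\<close>

lemma ennreal_firings_eq:
  assumes "lam \<noteq> \<infinity>"
  shows "ennreal_of_enat (firings lam \<rho> (config_of \<beta>) x) =
    (SUP xs. if legal_odo UNIV (occ \<beta>) \<rho> xs (\<lambda>_. 0) then of_nat (counts xs x) else 0)"
    (is "_ = (SUP xs. ?f xs)")
proof -
  let ?L = "{xs. legal_odo UNIV (occ \<beta>) \<rho> xs (\<lambda>_. 0)}"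
  have "ennreal_of_enat (firings lam \<rho> (config_of \<beta>) x) = (SUP xs\<in>?L. of_nat (counts xs x))"
    unfolding firings_eq[OF assms] ennreal_of_enat_Sup by (simp add: image_image)
  also have "\<dots> = (SUP xs. ?f xs)"
  proof (rule antisym)
    show "(SUP xs\<in>?L. of_nat (counts xs x)) \<le> (SUP xs. ?f xs)"
    proof (rule SUP_least)
      fix xs assume "xs \<in> ?L"
      then show "of_nat (counts xs x) \<le> (SUP xs. ?f xs)"
        by (intro SUP_upper2[of xs]) auto
    qed
    show "(SUP xs. ?f xs) \<le> (SUP xs\<in>?L. of_nat (counts xs x))"
    proof (rule SUP_least)
      fix xs
      show "?f xs \<le> (SUP xs\<in>?L. of_nat (counts xs x))"
        by (auto intro: SUP_upper2[of xs])
    qed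
  qed
  finally show ?thesis .
qed

abbreviation firings_at :: "ereal \<Rightarrow> int \<Rightarrow> (int \<Rightarrow> bool) \<times> stacks \<Rightarrow> ennreal" where
  "firings_at lam x \<equiv> (\<lambda>(\<beta>, \<rho>). ennreal_of_enat (firings lam \<rho> (config_of \<beta>) x))"

lemma measurable_joint:
  "(\<lambda>\<omega>. occ (fst \<omega>) x) \<in> joint_measure lam \<zeta> \<rightarrow>\<^sub>M count_space UNIV"
  "(\<lambda>\<omega>. snd \<omega> i) \<in> joint_measure lam \<zeta> \<rightarrow>\<^sub>M count_space UNIV"
  unfolding joint_measure_def occ_def of_bool_def by measurable

lemma measurable_firings_at:
  assumes "lam \<noteq> \<infinity>"
  shows "firings_at lam x \<in> borel_measurable (joint_measure lam \<zeta>)"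
proof -
  note pred_legal_odo[OF measurable_joint, measurable]
  have "(\<lambda>\<omega>. SUP xs. if legal_odo UNIV (occ (fst \<omega>)) (snd \<omega>) xs (\<lambda>_. 0)
      then of_nat (counts xs x) else 0 :: ennreal) \<in> borel_measurable (joint_measure lam \<zeta>)"
    by measurable
  then show ?thesis
    by (simp add: ennreal_firings_eq[OF assms] split_def)
qed

section \<open>Translation invariance and moments of the firings\<close>

lemma net_translate:
  "net UNIV (\<lambda>z. n (z + t)) (\<lambda>(z, k). \<rho> (z + t, k)) (\<lambda>z. u (z + t)) x = net UNIV n \<rho> u (x + t)"
  by (simp add: net_def jumps_def algebra_simps)

lemma legal_odo_translate:
  "legal_odo UNIV (\<lambda>z. n (z + t)) (\<lambda>(z, k). \<rho> (z + t, k)) (map (\<lambda>z. z - t) xs) (\<lambda>z. u (z + t))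
    \<longleftrightarrow> legal_odo UNIV n \<rho> xs u"
proof (induction xs arbitrary: u)
  case (Cons x xs)
  have "(\<lambda>z. u (z + t))(x - t := u (x - t + t) + 1) = (\<lambda>z. (u(x := u x + 1)) (z + t))"
    by (auto simp: fun_eq_iff)
  moreover have "fireable UNIV (\<lambda>z. n (z + t)) (\<lambda>(z, k). \<rho> (z + t, k)) (\<lambda>z. u (z + t)) (x - t)
      \<longleftrightarrow> fireable UNIV n \<rho> u x"
    unfolding fireable_def net_translate by (simp add: dozed_def)
  ultimately show ?case
    unfolding list.map legal_odo.simps using Cons[of "u(x := u x + 1)"]
    by (simp del: fun_upd_apply)
qed simp

lemma counts_map_diff: "counts (map (\<lambda>z. z - t) xs) x = counts xs (x + t)"
  by (induction xs) (auto simp: counts_def)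

lemma firings_translate:
  assumes "lam \<noteq> \<infinity>"
  shows "firings lam (\<lambda>(z, k). \<rho> (z + t, k)) (config_of (\<lambda>z. \<beta> (z + t))) 0 =
    firings lam \<rho> (config_of \<beta>) t"
proof -
  let ?L = "{xs. legal_odo UNIV (occ \<beta>) \<rho> xs (\<lambda>_. 0)}"
  have "{xs. legal_odo UNIV (occ (\<lambda>z. \<beta> (z + t))) (\<lambda>(z, k). \<rho> (z + t, k)) xs (\<lambda>_. 0)} =
      map (\<lambda>z. z - t) ` ?L" (is "?L' = _")
  proof -
    have l: "map (\<lambda>z. z - t) xs \<in> ?L' \<longleftrightarrow> xs \<in> ?L" for xs
      using legal_odo_translate[of "occ \<beta>" t \<rho> xs "\<lambda>_. 0"] by (simp add: occ_def)
    have inv: "map (\<lambda>z. z - t) (map (\<lambda>z. z + t) xs) = xs" for xs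
      by (simp add: o_def)
    show ?thesis
    proof (intro subset_antisym subsetI)
      fix xs assume "xs \<in> ?L'"
      then have "map (\<lambda>z. z + t) xs \<in> ?L" using l[of "map (\<lambda>z. z + t) xs"] unfolding inv by blast
      then have "map (\<lambda>z. z - t) (map (\<lambda>z. z + t) xs) \<in> map (\<lambda>z. z - t) ` ?L" by (rule imageI)
      then show "xs \<in> map (\<lambda>z. z - t) ` ?L" unfolding inv .
    next
      fix xs assume "xs \<in> map (\<lambda>z. z - t) ` ?L"
      then show "xs \<in> ?L'" using l by blast
    qed
  qed
  then show ?thesis
    unfolding firings_eq[OF assms] by (simp add: image_image counts_map_diff)
qed

lemma distr_PiM_iid_reindex:
  assumes "inj f"
  shows "distr (PiM UNIV (\<lambda>_. measure_pmf p)) (PiM UNIV (\<lambda>_. measure_pmf p)) (\<lambda>\<omega> i. \<omega> (f i)) =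
    PiM UNIV (\<lambda>_. measure_pmf p)"
  using distr_PiM_reindex[of UNIV "\<lambda>_. measure_pmf p" f UNIV] assms
  by (simp add: prob_space_measure_pmf restrict_UNIV)

lemma measurable_PiM_iid_reindex:
  "(\<lambda>\<omega> i. \<omega> (f i)) \<in> PiM UNIV (\<lambda>_. measure_pmf p) \<rightarrow>\<^sub>M PiM UNIV (\<lambda>_. measure_pmf p)"
  by (rule measurable_PiM_single') (auto intro: measurable_component_singleton)

text \<open>Both product laws are invariant under shifts, and the firings at \<open>t\<close> are
  the firings at 0 for shifted data. Thus one constant serves for the end points of all
  intervals.\<close>

lemma nn_integral_firings_at:
  assumes "lam \<noteq> \<infinity>"
  shows "(\<integral>\<^sup>+\<omega>. firings_at lam t \<omega> \<partial>joint_measure lam \<zeta>) =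
    (\<integral>\<^sup>+\<omega>. firings_at lam 0 \<omega> \<partial>joint_measure lam \<zeta>)"
proof -
  let ?B = "bernoulli_measure \<zeta>" and ?S = "stack_measure lam"
  let ?f = "\<lambda>\<beta> z. \<beta> (z + t)" and ?g = "\<lambda>\<rho> i. \<rho> (case i of (z, k) \<Rightarrow> (z + t, k))"
  have f: "?f \<in> ?B \<rightarrow>\<^sub>M ?B" and df: "distr ?B ?B ?f = ?B"
    unfolding bernoulli_measure_def
    by (rule measurable_PiM_iid_reindex, rule distr_PiM_iid_reindex) (simp add: inj_def)
  have g: "?g \<in> ?S \<rightarrow>\<^sub>M ?S" and dg: "distr ?S ?S ?g = ?S"
    unfolding stack_measure_def
    by (rule measurable_PiM_iid_reindex, rule distr_PiM_iid_reindex) (auto simp: inj_def)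
  interpret S: prob_space ?S by (rule prob_space_stack_measure)
  have "?B \<Otimes>\<^sub>M ?S = distr (?B \<Otimes>\<^sub>M ?S) (?B \<Otimes>\<^sub>M ?S) (\<lambda>(\<beta>, \<rho>). (?f \<beta>, ?g \<rho>))"
    using pair_measure_distr[OF f g] S.sigma_finite_measure_axioms by (simp add: df dg)
  then have "(\<integral>\<^sup>+\<omega>. firings_at lam 0 \<omega> \<partial>joint_measure lam \<zeta>) =
      (\<integral>\<^sup>+\<omega>. firings_at lam 0 \<omega> \<partial>distr (joint_measure lam \<zeta>) (joint_measure lam \<zeta>) (\<lambda>(\<beta>, \<rho>). (?f \<beta>, ?g \<rho>)))"
    by (simp only: joint_measure_def)
  also have "\<dots> = (\<integral>\<^sup>+\<omega>. firings_at lam 0 ((\<lambda>(\<beta>, \<rho>). (?f \<beta>, ?g \<rho>)) \<omega>) \<partial>joint_measure lam \<zeta>)"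
  proof (rule nn_integral_distr)
    show "(\<lambda>(\<beta>, \<rho>). (?f \<beta>, ?g \<rho>)) \<in> joint_measure lam \<zeta> \<rightarrow>\<^sub>M joint_measure lam \<zeta>"
      unfolding joint_measure_def split_beta
      by (intro measurable_Pair measurable_compose[OF measurable_fst f] measurable_compose[OF measurable_snd g[unfolded split_beta]])
  qed (simp add: measurable_firings_at[OF assms])
  also have "\<dots> = (\<integral>\<^sup>+\<omega>. firings_at lam t \<omega> \<partial>joint_measure lam \<zeta>)"
  proof (rule nn_integral_cong)
    fix \<omega>
    have "?g \<rho> = (\<lambda>(z, k). \<rho> (z + t, k))" for \<rho> :: stacks by auto
    then show "firings_at lam 0 ((\<lambda>(\<beta>, \<rho>). (?f \<beta>, ?g \<rho>)) \<omega>) = firings_at lam t \<omega>"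
      using firings_translate[OF assms, of "snd \<omega>" t "fst \<omega>"] by (simp add: split_def)
  qed
  finally show ?thesis ..
qed

text \<open>A natural number or infinity is at most its cube. The first moment is what controls the
  expected losses through the end points.\<close>

lemma nn_integral_firings_finite:
  assumes "firings_third_moment lam \<zeta> < \<infinity>"
  shows "(\<integral>\<^sup>+\<omega>. firings_at lam 0 \<omega> \<partial>joint_measure lam \<zeta>) < \<infinity>"
proof -
  have "ennreal_of_enat w \<le> ennreal_of_enat w ^ 3" for w
  proof (cases w)
    case (enat k)
    have "k \<le> k ^ 3" by (cases k) (auto simp: power3_eq_cube)
    then have "of_nat k \<le> (of_nat (k ^ 3) :: ennreal)" by (simp only: of_nat_mono)
    then show ?thesis by (simp add: enat)
  qed (simp add: power3_eq_cube ennreal_top_mult)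
  then have "(\<integral>\<^sup>+\<omega>. firings_at lam 0 \<omega> \<partial>joint_measure lam \<zeta>) \<le> firings_third_moment lam \<zeta>"
    unfolding firings_third_moment_def by (intro nn_integral_mono) (auto simp: split_def)
  then show ?thesis using assms by (rule order.strict_trans1)
qed

text \<open>Inside \<open>D\<close> the particle numbers of both dynamics agree because no site outside \<open>D\<close> has fired.\<close>

lemma legal_odo_UNIV:
  assumes "legal_odo D (occ (\<lambda>x. \<beta> x \<and> x \<in> D)) \<rho> xs u" "\<And>x. x \<notin> D \<Longrightarrow> u x = 0"
  shows "legal_odo UNIV (occ \<beta>) \<rho> xs u"
  using assms
proof (induction xs arbitrary: u)
  case (Cons x xs)
  let ?n = "occ (\<lambda>x. \<beta> x \<and> x \<in> D)"
  have "set (x # xs) \<subseteq> D" by (rule legal_odo_subset[OF Cons.prems(1)]) (simp add: occ_def)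
  then have x: "x \<in> D" by simp
  then have "net D ?n \<rho> u x = net UNIV (occ \<beta>) \<rho> u x" by (simp add: net_def occ_def)
  moreover have "legal_odo UNIV (occ \<beta>) \<rho> xs (u(x := u x + 1))"
  proof (rule Cons.IH)
    show "legal_odo D ?n \<rho> xs (u(x := u x + 1))" using Cons.prems(1) by simp
    show "(u(x := u x + 1)) z = 0" if "z \<notin> D" for z using Cons.prems(2)[OF that] x that by auto
  qed
  ultimately show ?case using Cons.prems(1) by (simp add: fireable_def)
qed simp

text \<open>Legal sequences in the interval are legal on the line, so \<open>w\<close> bounds them
  and a halting one exists. Every particle lost on the left or right uses a firing of
  \<open>a\<close> or of \<open>b\<close>, so at most \<open>w a + w b\<close> are lost.\<close>

lemma retains_if_firings_finite:
  assumes "lam \<noteq> \<infinity>" "a \<le> b" "\<And>x. x \<in> {a..b} \<Longrightarrow> firings lam \<rho> (config_of \<beta>) x = enat (w x)"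
    and "c + real (w a) + real (w b) \<le> real (\<Sum>x\<in>{a..b}. of_bool (\<beta> x))"
  shows "retains {a..b} (occ (\<lambda>x. \<beta> x \<and> x \<in> {a..b})) c \<rho>"
proof -
  let ?D = "{a..b}"
  let ?n = "occ (\<lambda>x. \<beta> x \<and> x \<in> ?D)"
  have z: "?n x = 0" if "x \<notin> ?D" for x using that by (simp add: occ_def)
  have le: "counts xs x \<le> w x" if "legal_odo ?D ?n \<rho> xs (\<lambda>_. 0)" "x \<in> ?D" for xs x
  proof -
    have "legal_odo UNIV (occ \<beta>) \<rho> xs (\<lambda>_. 0)" by (rule legal_odo_UNIV[OF that(1)]) simp
    then have "enat (counts xs x) \<le> firings lam \<rho> (config_of \<beta>) x"
      unfolding firings_eq[OF assms(1)] by (intro SUP_upper) simp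
    then show ?thesis using assms(3)[OF that(2)] by simp
  qed
  obtain xs where xs: "halts ?D ?n \<rho> xs"
    using halts_exists[of ?D ?n \<rho> w] z le by auto
  have st: "stabilizing ?D ?n \<rho> (counts xs)" by (rule halts_stabilizing[OF xs z])
  have l: "legal_odo ?D ?n \<rho> xs (\<lambda>_. 0)" using xs by (simp add: halts_def)
  have "(\<Sum>x\<in>?D. net ?D ?n \<rho> (counts xs) x) =
      int (\<Sum>x\<in>?D. ?n x) - jumps GoLeft \<rho> a (counts xs a) - jumps GoRight \<rho> b (counts xs b)"
    by (rule sum_net[OF assms(2)]) (use st in \<open>auto simp: stabilizing_def\<close>)
  moreover have "jumps GoLeft \<rho> a (counts xs a) \<le> int (w a)"
    using jumps_le[of GoLeft \<rho> a "counts xs a"] le[OF l, of a] assms(2) by auto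
  moreover have "jumps GoRight \<rho> b (counts xs b) \<le> int (w b)"
    using jumps_le[of GoRight \<rho> b "counts xs b"] le[OF l, of b] assms(2) by auto
  moreover have "(\<Sum>x\<in>?D. ?n x) = (\<Sum>x\<in>?D. of_bool (\<beta> x))"
    by (intro sum.cong) (auto simp: occ_def)
  ultimately have "c \<le> real_of_int (\<Sum>x\<in>?D. net ?D ?n \<rho> (counts xs) x)"
    using assms(4) by linarith
  with st show ?thesis unfolding retains_def by blast
qed

text \<open>Taking expectations in a pointwise bound: the number of initial particles is at most
  \<open>c\<close>, plus the interval length on the event of retaining \<open>c\<close>, plus the
  firings at the two end points.\<close>

lemma prob_retains_ge:
  assumes "0 < lam" "lam \<noteq> \<infinity>" "0 < \<zeta>" "\<zeta> < 1" "a \<le> b" "0 \<le> c"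
    and K: "(\<integral>\<^sup>+\<omega>. firings_at lam 0 \<omega> \<partial>joint_measure lam \<zeta>) = ennreal K" "0 \<le> K"
  shows "\<zeta> * real (card {a..b}) \<le> c + 2 * K + real (card {a..b}) *
    measure (stack_measure lam) {\<rho>. retains {a..b} (occ (\<lambda>x. x \<in> {a..b})) c \<rho>}"
proof -
  let ?D = "{a..b}" and ?J = "joint_measure lam \<zeta>" and ?B = "bernoulli_measure \<zeta>" and ?S = "stack_measure lam"
  define N where "N = card ?D"
  define q where "q = measure ?S {\<rho>. retains ?D (occ (\<lambda>x. x \<in> ?D)) c \<rho>}"
  have q0: "0 \<le> q" by (simp add: q_def)
  interpret S: prob_space ?S by (rule prob_space_stack_measure)
  interpret B: prob_space ?B by (rule prob_space_bernoulli_measure)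
  interpret BS: pair_prob_space ?B ?S ..
  interpret J: prob_space ?J unfolding joint_measure_def by unfold_locales
  have spJ: "space ?J = UNIV" by (simp add: joint_measure_def space_pair_measure)
  define H where "H = {\<omega>. retains ?D (occ (\<lambda>x. fst \<omega> x \<and> x \<in> ?D)) c (snd \<omega>)}"
  have H: "H \<in> sets ?J"
  proof -
    have "(\<lambda>\<omega>. occ (\<lambda>x. fst \<omega> x \<and> x \<in> ?D) y) \<in> ?J \<rightarrow>\<^sub>M count_space UNIV" for y
      unfolding joint_measure_def occ_def of_bool_def by measurable
    from pred_retains[OF this measurable_joint(2), where D = ?D and c = c]
    show ?thesis by (simp add: H_def pred_def spJ)
  qed
  note measurable_firings_at[OF assms(2), measurable]
  have int_w: "(\<integral>\<^sup>+\<omega>. firings_at lam x \<omega> \<partial>?J) = ennreal K" for x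
    using nn_integral_firings_at[OF assms(2), of \<zeta> x] K by simp
  \<comment> \<open>Each expectation is finite and there are countably many sites, so almost surely
    all sites fire finitely often.\<close>
  have fin: "AE \<omega> in ?J. \<forall>x. firings_at lam x \<omega> \<noteq> \<infinity>"
    unfolding AE_all_countable
  proof
    fix x
    show "AE \<omega> in ?J. firings_at lam x \<omega> \<noteq> \<infinity>"
      by (rule nn_integral_noteq_infinite) (simp_all add: int_w)
  qed
  have mX [measurable]: "(\<lambda>\<omega>. of_bool (fst \<omega> x) :: ennreal) \<in> borel_measurable ?J" for x
    unfolding joint_measure_def of_bool_def by measurable
  have EX: "(\<integral>\<^sup>+\<omega>. of_bool (fst \<omega> x) \<partial>?J) = ennreal \<zeta>" for x
  proof -
    have d: "distr ?B (measure_pmf (bernoulli_pmf \<zeta>)) (\<lambda>\<beta>. \<beta> x) = measure_pmf (bernoulli_pmf \<zeta>)"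
      unfolding bernoulli_measure_def
      by (rule product_prob_space.PiM_component) (simp_all add: product_prob_spaceI prob_space_measure_pmf)
    have "(\<integral>\<^sup>+\<omega>. of_bool (fst \<omega> x) \<partial>?J) = (\<integral>\<^sup>+\<beta>. \<integral>\<^sup>+\<rho>. of_bool (fst (\<beta>, \<rho>) x) \<partial>?S \<partial>?B)"
      using S.nn_integral_fst[OF mX[of x, unfolded joint_measure_def]] by (simp only: joint_measure_def)
    also have "\<dots> = (\<integral>\<^sup>+\<beta>. of_bool (\<beta> x) \<partial>?B)"
      by (simp add: S.emeasure_space_1[simplified])
    also have "\<dots> = (\<integral>\<^sup>+y. of_bool y \<partial>distr ?B (measure_pmf (bernoulli_pmf \<zeta>)) (\<lambda>\<beta>. \<beta> x))"
      by (subst nn_integral_distr) simp_all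
    also have "\<dots> = ennreal \<zeta>"
      unfolding d using assms(3,4)
      by (subst nn_integral_measure_pmf_finite) (auto simp: UNIV_bool)
    finally show ?thesis .
  qed
  \<comment> \<open>For a fixed occupation the stacks are integrated first; the sample restricted to
    the interval is then compared with the full interval.\<close>
  have "emeasure ?J H \<le> ennreal q"
  proof -
    have "emeasure ?J H = (\<integral>\<^sup>+\<beta>. emeasure ?S (Pair \<beta> -` H) \<partial>?B)"
      using H unfolding joint_measure_def by (rule S.emeasure_pair_measure_alt)
    also have "\<dots> \<le> (\<integral>\<^sup>+\<beta>. ennreal q \<partial>?B)"
    proof (rule nn_integral_mono)
      fix \<beta>
      have "measure ?S {\<rho>. retains ?D (occ (\<lambda>x. x \<in> {x. \<beta> x} \<inter> ?D)) c \<rho>} \<le> q"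
        unfolding q_def by (rule prob_retains_le_full[OF assms(1,2)]) simp
      then show "emeasure ?S (Pair \<beta> -` H) \<le> ennreal q"
        by (simp add: H_def vimage_def S.emeasure_eq_measure ennreal_leI)
    qed
    also have "\<dots> = ennreal q" by (simp add: B.emeasure_space_1[simplified])
    finally show ?thesis .
  qed
  \<comment> \<open>On \<open>H\<close> the particle number is at most \<open>N\<close>. Off
    \<open>H\<close> it is below \<open>c\<close> plus the firings at \<open>a\<close> and
    \<open>b\<close>, since otherwise \<open>c\<close> particles would be retained.\<close>
  have ae: "AE \<omega> in ?J. (\<Sum>x\<in>?D. of_bool (fst \<omega> x)) \<le>
      ennreal c + of_nat N * indicator H \<omega> + firings_at lam a \<omega> + firings_at lam b \<omega>"
    using fin
  proof eventually_elim
    case (elim \<omega>)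
    let ?w = "\<lambda>x. firings lam (snd \<omega>) (config_of (fst \<omega>)) x"
    let ?X = "\<Sum>x\<in>?D. of_bool (fst \<omega> x) :: nat"
    have X: "(\<Sum>x\<in>?D. of_bool (fst \<omega> x)) = (of_nat ?X :: ennreal)" by simp
    show ?case
    proof (cases "\<omega> \<in> H")
      case True
      have "?X \<le> (\<Sum>x\<in>?D. 1)" by (intro sum_mono) auto
      then have "?X \<le> N" by (simp add: N_def)
      then have "(of_nat ?X :: ennreal) \<le> of_nat N" by (rule of_nat_mono)
      also have "\<dots> \<le> ennreal c + of_nat N * indicator H \<omega> + firings_at lam a \<omega> + firings_at lam b \<omega>"
        using True by (simp add: add.assoc add_increasing add_increasing2)
      finally show ?thesis unfolding X .
    next
      case False
      define v where "v x = the_enat (?w x)" for x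
      have v: "?w x = enat (v x)" for x
        using elim[rule_format, of x] by (cases "?w x") (auto simp: split_def v_def)
      have "\<not> (c + real (v a) + real (v b) \<le> real ?X)"
        using retains_if_firings_finite[OF assms(2,5), where \<rho> = "snd \<omega>" and \<beta> = "fst \<omega>" and w = v and c = c] v False
        by (auto simp: H_def)
      then have "ennreal (real ?X) \<le> ennreal (c + real (v a) + real (v b))"
        by (intro ennreal_leI) simp
      also have "\<dots> = ennreal c + firings_at lam a \<omega> + firings_at lam b \<omega>"
        using assms(6) by (simp add: split_def v ennreal_of_nat_eq_real_of_nat)
      finally show ?thesis unfolding X using False
        by (simp add: ennreal_of_nat_eq_real_of_nat)
    qed
  qed
  have "(\<integral>\<^sup>+\<omega>. (\<Sum>x\<in>?D. of_bool (fst \<omega> x)) \<partial>?J) = (\<Sum>x\<in>?D. \<integral>\<^sup>+\<omega>. of_bool (fst \<omega> x) \<partial>?J)"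
    by (rule nn_integral_sum) (rule mX)
  also have "\<dots> = of_nat N * ennreal \<zeta>" unfolding EX N_def by simp
  also have "\<dots> = ennreal (\<zeta> * real N)"
    using assms(3) by (simp add: ennreal_mult ennreal_of_nat_eq_real_of_nat mult.commute)
  finally have "ennreal (\<zeta> * real N) = (\<integral>\<^sup>+\<omega>. (\<Sum>x\<in>?D. of_bool (fst \<omega> x)) \<partial>?J)" ..
  also have "\<dots> \<le> (\<integral>\<^sup>+\<omega>. ennreal c + of_nat N * indicator H \<omega> + firings_at lam a \<omega> + firings_at lam b \<omega> \<partial>?J)"
    by (rule nn_integral_mono_AE[OF ae])
  also have "\<dots> = ennreal c + of_nat N * emeasure ?J H + ennreal K + ennreal K"
    using H by (simp add: nn_integral_add nn_integral_cmult int_w J.emeasure_space_1)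
  also have "\<dots> \<le> ennreal c + of_nat N * ennreal q + ennreal K + ennreal K"
    using \<open>emeasure ?J H \<le> ennreal q\<close> by (intro add_mono mult_left_mono) auto
  also have "\<dots> = ennreal (c + real N * q + K + K)"
    using assms(6) K(2) q0 by (simp add: ennreal_of_nat_eq_real_of_nat ennreal_mult[symmetric] del: ennreal_plus flip: ennreal_plus)
  finally have "\<zeta> * real N \<le> c + real N * q + K + K"
    using assms(6) K(2) q0 by (subst (asm) ennreal_le_iff) auto
  then show ?thesis by (simp add: N_def q_def)
qed

section \<open>Lower bounds for the inner density\<close>

lemma inner_density_on_ge:
  assumes "0 < card I"
    and "\<And>\<zeta>. 0 < \<zeta> \<Longrightarrow> \<zeta> < \<xi> \<Longrightarrow> 1 / real (card I) ^ 20 <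
      measure (stack_measure lam) {\<rho>. \<zeta> * real (card I) <
        real (num_sleeping (stabilization lam I \<rho> (config_of (\<lambda>x. x \<in> I))))}"
    and "\<And>\<rho>. real (num_sleeping (stabilization lam I \<rho> (config_of (\<lambda>x. x \<in> I)))) \<le> C"
  shows "\<xi> \<le> inner_density_on lam I"
proof -
  let ?P = "\<lambda>\<zeta>. measure (stack_measure lam) {\<rho>. \<zeta> * real (card I) <
        real (num_sleeping (stabilization lam I \<rho> (config_of (\<lambda>x. x \<in> I))))}"
  have eq: "inner_density_on lam I = Inf {\<zeta>. 0 < \<zeta> \<and> ?P \<zeta> \<le> 1 / real (card I) ^ 20}"
    by (simp add: inner_density_on_def)
  \<comment> \<open>The value \<open>\<bar>C\<bar> + 1\<close> is a positive density that is never
    exceeded. It shows that the infimum is over a nonempty set, so that a lower bound of the set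
    bounds the infimum.\<close>
  have "C \<le> \<bar>C\<bar> + 1" by simp
  also have "\<dots> \<le> (\<bar>C\<bar> + 1) * real (card I)"
    using assms(1) mult_left_mono[of 1 "real (card I)" "\<bar>C\<bar> + 1"] by simp
  finally have "{\<rho>. (\<bar>C\<bar> + 1) * real (card I) <
      real (num_sleeping (stabilization lam I \<rho> (config_of (\<lambda>x. x \<in> I))))} = {}"
    using assms(3) by (auto simp: not_less intro: order_trans)
  then have "?P (\<bar>C\<bar> + 1) = 0" by simp
  then have "\<bar>C\<bar> + 1 \<in> {\<zeta>. 0 < \<zeta> \<and> ?P \<zeta> \<le> 1 / real (card I) ^ 20}" by simp
  moreover have "\<xi> \<le> \<zeta>" if "\<zeta> \<in> {\<zeta>. 0 < \<zeta> \<and> ?P \<zeta> \<le> 1 / real (card I) ^ 20}" for \<zeta>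
    using that assms(2)[of \<zeta>] by force
  ultimately show ?thesis unfolding eq by (intro cInf_greatest) auto
qed

text \<open>The initial \<open>settle\<close> puts every particle to sleep, so the empty sequence is
  the only legal one.\<close>

lemma num_sleeping_infinite_rate:
  "num_sleeping (stabilization \<infinity> D \<rho> (config_of (\<lambda>x. x \<in> D))) = card D"
proof -
  let ?\<eta> = "\<lambda>x. if x \<in> D then Asleep else Awake 0"
  have init: "init \<infinity> (config_of (\<lambda>x. x \<in> D)) = (?\<eta>, \<lambda>_. 0)"
    by (auto simp: init_def settle_def config_of_def fall_asleep_def)
  have "legal \<infinity> D \<rho> xs (?\<eta>, \<lambda>_. 0) \<longleftrightarrow> xs = []" for xs
    by (cases xs) auto
  then have "stabilization \<infinity> D \<rho> (config_of (\<lambda>x. x \<in> D)) = ?\<eta>"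
    unfolding stabilization_def init
  proof (intro the_equality)
    show "\<exists>xs. legal \<infinity> D \<rho> xs (?\<eta>, \<lambda>_. 0) \<and> ?\<eta> = fst (run \<infinity> D \<rho> xs (?\<eta>, \<lambda>_. 0)) \<and> stable ?\<eta>"
      by (rule exI[of _ "[]"]) (simp add: stable_def)
  qed (metis run.simps(1) fst_conv)
  then show ?thesis by (simp add: num_sleeping_def)
qed

text \<open>The bound covers every stack: for those without a halting sequence the default value
  \<open>?d\<close> is added.\<close>

lemma num_sleeping_bounded:
  assumes "finite D"
  obtains C where "\<And>\<rho>. real (num_sleeping (stabilization lam D \<rho> (config_of (\<lambda>x. x \<in> D)))) \<le> C"
proof
  fix \<rho>
  let ?n = "occ (\<lambda>x. x \<in> D)" and ?d = "num_sleeping (THE \<eta>. False)"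
  have z: "?n x = 0" if "x \<notin> D" for x using that by (simp add: occ_def)
  have "num_sleeping (stabilization lam D \<rho> (config_of (\<lambda>x. x \<in> D))) \<le> card D + ?d"
  proof (cases "lam \<noteq> \<infinity> \<and> (\<exists>xs. halts D ?n \<rho> xs)")
    case True
    then obtain xs where lam: "lam \<noteq> \<infinity>" and xs: "halts D ?n \<rho> xs" by blast
    have "int (num_sleeping (stabilization lam D \<rho> (config_of (\<lambda>x. x \<in> D)))) =
        (\<Sum>x\<in>D. net D ?n \<rho> (counts xs) x)"
      using stabilization_eq[OF lam xs] num_sleeping_config_at[OF assms xs z] by simp
    also have "\<dots> \<le> (\<Sum>x\<in>D. 1)"
      using halts_stabilizing[OF xs z] by (intro sum_mono) (simp add: stabilizing_def)
    finally show ?thesis by simp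
  qed (cases "lam = \<infinity>"; simp add: stabilization_none num_sleeping_infinite_rate)
  then show "real (num_sleeping (stabilization lam D \<rho> (config_of (\<lambda>x. x \<in> D)))) \<le> real (card D + ?d)"
    by (rule of_nat_mono)
qed

lemma inner_density_on_finite_rate:
  assumes "0 < lam" "lam \<noteq> \<infinity>" "0 < \<zeta>" "\<zeta> < 1" "0 \<le> \<xi>" "a \<le> b"
    and K: "(\<integral>\<^sup>+\<omega>. firings_at lam 0 \<omega> \<partial>joint_measure lam \<zeta>) = ennreal K" "0 \<le> K"
    and large: "2 * K + 1 < (\<zeta> - \<xi>) * real (card {a..b})"
  shows "\<xi> \<le> inner_density_on lam {a..b}"
proof -
  let ?D = "{a..b}" and ?M = "stack_measure lam"
  let ?F = "\<lambda>\<rho>. real (num_sleeping (stabilization lam ?D \<rho> (config_of (\<lambda>x. x \<in> ?D))))"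
  define N where "N = real (card ?D)"
  interpret prob_space ?M by (rule prob_space_stack_measure)
  have N: "1 \<le> N" using assms(6) by (simp add: N_def)
  define q where "q = prob {\<rho>. retains ?D (occ (\<lambda>x. x \<in> ?D)) (\<xi> * N) \<rho>}"
  have "\<zeta> * N \<le> \<xi> * N + 2 * K + N * q"
    unfolding N_def q_def
    by (rule prob_retains_ge) (use assms in auto)
  moreover have "2 * K + 1 < (\<zeta> - \<xi>) * N" using large by (simp only: N_def)
  \<comment> \<open>The summand 1 in \<open>large\<close> gives \<open>q > 1 / N\<close>, which
    already exceeds the threshold \<open>1 / N ^ 20\<close> because
    \<open>N \<ge> 1\<close>.\<close>
  ultimately have "1 < q * N" by (simp add: algebra_simps)
  then have "1 / N < q" using N by (simp add: divide_simps)
  moreover have "1 / N ^ 20 \<le> 1 / N"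
    using N power_increasing[of 1 20 N] by (intro divide_left_mono) auto
  ultimately have q: "1 / N ^ 20 < q" by simp
  obtain C where C: "\<And>\<rho>. ?F \<rho> \<le> C"
    using num_sleeping_bounded[of ?D lam] by blast
  show ?thesis
  proof (rule inner_density_on_ge[OF _ _ C])
    show "0 < card ?D" using assms(6) by simp
    \<comment> \<open>The gap between the two densities turns retaining at least
      \<open>\<xi> * N\<close> particles into the strict inequality in the definition of the inner
      density.\<close>
    fix \<zeta>' :: real assume "0 < \<zeta>'" "\<zeta>' < \<xi>"
    have "q \<le> prob {\<rho>. \<zeta>' * N < ?F \<rho>}"
      unfolding q_def
    proof (rule finite_measure_mono)
      show "{\<rho>. retains ?D (occ (\<lambda>x. x \<in> ?D)) (\<xi> * N) \<rho>} \<subseteq> {\<rho>. \<zeta>' * N < ?F \<rho>}"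
      proof safe
        fix \<rho> assume "retains ?D (occ (\<lambda>x. x \<in> ?D)) (\<xi> * N) \<rho>"
        then have "\<xi> * N \<le> ?F \<rho>" by (intro num_sleeping_ge) (use assms in auto)
        moreover have "\<zeta>' * N < \<xi> * N" using \<open>\<zeta>' < \<xi>\<close> N by simp
        ultimately show "\<zeta>' * N < ?F \<rho>" by simp
      qed
      show "{\<rho>. \<zeta>' * N < ?F \<rho>} \<in> events"
        by (rule sets_num_sleeping) (use assms in auto)
    qed
    with q show "1 / real (card ?D) ^ 20 < prob {\<rho>. \<zeta>' * real (card ?D) < ?F \<rho>}"
      by (simp add: N_def)
  qed
qed

text \<open>All particles survive, so each density below 1 is exceeded surely. Two sites are
  required to make \<open>1 / real (card {a..b}) ^ 20\<close> strictly less than 1.\<close>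

lemma inner_density_on_infinite_rate:
  assumes "a < b"
  shows "1 \<le> inner_density_on \<infinity> {a..b}"
proof (rule inner_density_on_ge[where C = "real (card {a..b})"])
  interpret prob_space "stack_measure \<infinity>" by (rule prob_space_stack_measure)
  have card: "1 < real (card {a..b})" using assms by simp
  then show "0 < card {a..b}" by simp
  fix \<zeta> :: real assume "\<zeta> < 1"
  then have "{\<rho>. \<zeta> * real (card {a..b}) <
      real (num_sleeping (stabilization \<infinity> {a..b} \<rho> (config_of (\<lambda>x. x \<in> {a..b}))))} = space (stack_measure \<infinity>)"
    using card unfolding num_sleeping_infinite_rate by simp
  moreover have "1 / real (card {a..b}) ^ 20 < 1"
  proof -
    have "1 / c ^ 20 < 1" if "1 < c" for c :: real
    proof -
      have "0 < c ^ 20" using that by simp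
      with one_less_power[OF that, of 20] show ?thesis by (simp only: divide_less_eq_1_pos)
    qed
    from this[OF card] show ?thesis .
  qed
  ultimately show "1 / real (card {a..b}) ^ 20 < prob {\<rho>. \<zeta> * real (card {a..b}) <
      real (num_sleeping (stabilization \<infinity> {a..b} \<rho> (config_of (\<lambda>x. x \<in> {a..b}))))}"
    by (simp only: prob_space)
next
  show "real (num_sleeping (stabilization \<infinity> {a..b} \<rho> (config_of (\<lambda>x. x \<in> {a..b})))) \<le> real (card {a..b})" for \<rho>
    by (simp only: num_sleeping_infinite_rate)
qed

lemma inner_density_ge:
  assumes "\<And>a b. a \<le> b \<Longrightarrow> n \<le> card {a..b} \<Longrightarrow> \<xi> \<le> inner_density_on lam {a..b}"
  shows "ereal \<xi> \<le> inner_density lam"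
  unfolding inner_density_def
proof (rule le_Limsup[OF large_intervals_neq_bot])
  show "\<forall>\<^sub>F I in large_intervals. ereal \<xi> \<le> ereal (inner_density_on lam I)"
    unfolding eventually_large_intervals using assms by auto
qed

lemma inner_density_ge_subcritical:
  assumes "0 < lam" "0 < \<zeta>" "\<zeta> < 1" "firings_third_moment lam \<zeta> < \<infinity>" "0 \<le> \<xi>" "\<xi> < \<zeta>"
  shows "ereal \<xi> \<le> inner_density lam"
proof (cases "lam = \<infinity>")
  case True
  show ?thesis unfolding True
  proof (rule inner_density_ge[where n = 2])
    fix a b :: int assume "2 \<le> card {a..b}"
    then have "a < b" by simp
    then have "1 \<le> inner_density_on \<infinity> {a..b}" by (rule inner_density_on_infinite_rate)
    then show "\<xi> \<le> inner_density_on \<infinity> {a..b}" using assms by simp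
  qed
next
  case False
  obtain K where K: "(\<integral>\<^sup>+\<omega>. firings_at lam 0 \<omega> \<partial>joint_measure lam \<zeta>) = ennreal K" "0 \<le> K"
    using nn_integral_firings_finite[OF assms(4)]
    by (cases "\<integral>\<^sup>+\<omega>. firings_at lam 0 \<omega> \<partial>joint_measure lam \<zeta>") auto
  \<comment> \<open>From this length on the interval meets the size condition
    \<open>2 * K + 1 < (\<zeta> - \<xi>) * real (card {a..b})\<close>.\<close>
  obtain n where n: "(2 * K + 1) / (\<zeta> - \<xi>) < real n" using reals_Archimedean2 by blast
  show ?thesis
  proof (rule inner_density_ge[where n = n])
    fix a b :: int assume ab: "a \<le> b" "n \<le> card {a..b}"
    have "(2 * K + 1) / (\<zeta> - \<xi>) < real (card {a..b})"
      using n ab(2) by (meson less_le_trans of_nat_le_iff)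
    then have "2 * K + 1 < (\<zeta> - \<xi>) * real (card {a..b})"
      using assms(6) by (simp only: divide_less_eq mult.commute diff_gt_0_iff_gt if_True)
    then show "\<xi> \<le> inner_density_on lam {a..b}"
      by (intro inner_density_on_finite_rate[OF assms(1) False assms(2,3,5) ab(1) K])
  qed
qed

theorem corollary2:
  fixes lam :: ereal
  assumes "0 < lam"
  shows "inner_density lam \<ge> ereal (outer_density lam)"
proof -
  let ?S = "{\<zeta>. 0 < \<zeta> \<and> \<zeta> < 1 \<and> firings_third_moment lam \<zeta> < \<infinity>}"
  have inner: "ereal \<zeta> \<le> inner_density lam" if "\<zeta> \<in> ?S" for \<zeta>
  \<comment> \<open>The bound is known only for densities strictly below \<open>\<zeta>\<close> that
    are nonnegative, hence the approximation from below and the \<open>max 0 \<xi>\<close>.\<close>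
  proof (rule dense_le)
    fix y assume y: "y < ereal \<zeta>"
    show "y \<le> inner_density lam"
    proof (cases y)
      case (real \<xi>)
      then have "max 0 \<xi> < \<zeta>" using y that by auto
      then have "ereal (max 0 \<xi>) \<le> inner_density lam"
        using that by (intro inner_density_ge_subcritical[OF assms, of \<zeta>]) auto
      then show ?thesis unfolding real by (rule order_trans[rotated]) simp
    qed (use y in auto)
  qed
  \<comment> \<open>This handles the element 0 inserted into the supremum. With
    \<open>\<xi> = 0\<close> the probability estimate is vacuous, as no density lies strictly
    between 0 and 0.\<close>
  have "ereal 0 \<le> inner_density lam"
  proof (rule inner_density_ge)
    fix a b :: int assume "a \<le> b"
    obtain C where C: "\<And>\<rho>. real (num_sleeping (stabilization lam {a..b} \<rho> (config_of (\<lambda>x. x \<in> {a..b})))) \<le> C"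
      using num_sleeping_bounded[of "{a..b}" lam] by blast
    show "0 \<le> inner_density_on lam {a..b}"
      by (rule inner_density_on_ge[OF _ _ C]) (use \<open>a \<le> b\<close> in auto)
  qed
  with inner have le: "ereal \<zeta> \<le> inner_density lam" if "\<zeta> \<in> insert 0 ?S" for \<zeta>
    using that by blast
  show ?thesis
  \<comment> \<open>Nonnegativity excludes the value \<open>-\<infinity>\<close>, and the value
    \<open>\<infinity>\<close> is trivial.\<close>
  proof (cases "inner_density lam")
    case (real r)
    have "outer_density lam \<le> r"
      unfolding outer_density_def by (rule cSup_least) (use le real in auto)
    then show ?thesis by (simp add: real)
  qed (use le[of 0] in auto)
qed

end
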